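(* Suppose there is a positive constant $C$ such that $\tau(\beta)\ge C$ for every normalized cubic metrized graph $\beta$. Then $\tau(\Gamma)\ge C$ for every normalized metrized graph $\Gamma$.
   Context: A metrized graph $\Gamma$ is a finite connected graph (multiple edges and self-loops allowed) in which each edge is identified with a closed line segment of some positive length; its vertex set is a finite nonempty set of points containing all points of valence different from $2$. $\Gamma$ is normalized if its total length $\ell(\Gamma)$ (sum of edge lengths) equals $1$. A metrized graph is cubic if it has a vertex set in which every vertex has valence $3$. Let $r(x,y)$ be the effective resistance between $x,y$ when $\Gamma$ is viewed as an electric circuit with edge resistances equal to edge lengths. The tau constant is $\tau(\Gamma)=\frac14\int_\Gamma\big(\frac{\partial}{\partial x}r(x,y)\big)^2dx$, independent of $y\in\Gamma$. *)

theory Defs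
  imports "HOL-Analysis.Analysis" "Graph_Theory.Digraph_Component"
begin

text \<open>
  A metrized graph is presented by a finite connected multigraph \<open>G\<close> (loops and parallel
  arcs allowed) with edge lengths \<open>l\<close>. The direction of an arc \<open>e\<close> only serves to
  parametrize the edge by \<open>{0..l e}\<close>, from tail to head.
\<close>

locale metrized_graph = fin_digraph G for G :: "('v,'e) pre_digraph" +
  fixes l :: "'e \<Rightarrow> real"
  assumes connected: "Digraph_Component.connected G"
    and length_pos: "e \<in> arcs G \<Longrightarrow> l e > 0"

definition total_length :: "('v,'e) pre_digraph \<Rightarrow> ('e \<Rightarrow> real) \<Rightarrow> real" where
  "total_length G l = (\<Sum>e\<in>arcs G. l e)"

definition normalized :: "('v,'e) pre_digraph \<Rightarrow> ('e \<Rightarrow> real) \<Rightarrow> bool" where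
  "normalized G l \<longleftrightarrow> total_length G l = 1"


section \<open>Points, valence and vertex sets\<close>

text \<open>\<open>Inner e t\<close> is the point of the edge \<open>e\<close> at distance \<open>t\<close> from its tail along \<open>e\<close>.\<close>

datatype ('v,'e) point = Vertex 'v | Inner 'e real

definition points :: "('v,'e) pre_digraph \<Rightarrow> ('e \<Rightarrow> real) \<Rightarrow> ('v,'e) point set" where
  "points G l = Vertex ` verts G \<union> {Inner e t |e t. e \<in> arcs G \<and> 0 < t \<and> t < l e}"

definition edge_point ::
  "('v,'e) pre_digraph \<Rightarrow> ('e \<Rightarrow> real) \<Rightarrow> 'e \<Rightarrow> real \<Rightarrow> ('v,'e) point" where
  "edge_point G l e t =
     (if t \<le> 0 then Vertex (tail G e) else if t \<ge> l e then Vertex (head G e) else Inner e t)"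

text \<open>A loop contributes 2 to the valence of its vertex.\<close>

fun valence :: "('v,'e) pre_digraph \<Rightarrow> ('v,'e) point \<Rightarrow> nat" where
  "valence G (Vertex v) = out_degree G v + in_degree G v"
| "valence G (Inner e t) = 2"

text \<open>
  \<open>verts G\<close> may contain points of valence 2 and is only one of the vertex sets of the
  metrized graph.
\<close>

definition is_vertex_set ::
  "('v,'e) pre_digraph \<Rightarrow> ('e \<Rightarrow> real) \<Rightarrow> ('v,'e) point set \<Rightarrow> bool" where
  "is_vertex_set G l S \<longleftrightarrow>
     finite S \<and> S \<noteq> {} \<and> S \<subseteq> points G l \<and> {p \<in> points G l. valence G p \<noteq> 2} \<subseteq> S"

definition cubic :: "('v,'e) pre_digraph \<Rightarrow> ('e \<Rightarrow> real) \<Rightarrow> bool" where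
  "cubic G l \<longleftrightarrow> (\<exists>S. is_vertex_set G l S \<and> (\<forall>p\<in>S. valence G p = 3))"


section \<open>Effective resistance\<close>

text \<open>
  \<open>\<phi>\<close> is the potential on the nodes of the network \<open>N\<close> with resistances \<open>R\<close> when a unit
  current enters at \<open>x\<close> and leaves at \<open>y\<close> (Ohm's law and Kirchhoff's current law).
\<close>

definition unit_current_potential ::
  "('a,'b) pre_digraph \<Rightarrow> ('b \<Rightarrow> real) \<Rightarrow> 'a \<Rightarrow> 'a \<Rightarrow> ('a \<Rightarrow> real) \<Rightarrow> bool" where
  "unit_current_potential N R x y \<phi> \<longleftrightarrow>
     (\<forall>v\<in>verts N.
        (\<Sum>e\<in>out_arcs N v. (\<phi> v - \<phi> (head N e)) / R e)
        + (\<Sum>e\<in>in_arcs N v. (\<phi> v - \<phi> (tail N e)) / R e)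
        = of_bool (v = x) - of_bool (v = y))"

definition network_resistance ::
  "('a,'b) pre_digraph \<Rightarrow> ('b \<Rightarrow> real) \<Rightarrow> 'a \<Rightarrow> 'a \<Rightarrow> real" where
  "network_resistance N R x y =
     (THE r. \<exists>\<phi>. unit_current_potential N R x y \<phi> \<and> r = \<phi> x - \<phi> y)"

text \<open>
  For arbitrary points, the circuit is the graph subdivided at these points: its nodes are
  the vertices of \<open>G\<close> and the points in \<open>P\<close>, and its arcs are the segments \<open>(e, a, b)\<close> of
  edges \<open>e\<close> between consecutive breakpoints \<open>a < b\<close>.
\<close>

definition breakpoints :: "('e \<Rightarrow> real) \<Rightarrow> ('v,'e) point set \<Rightarrow> 'e \<Rightarrow> real set" where
  "breakpoints l P e = {0, l e} \<union> {t. Inner e t \<in> P}"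

definition subdivide ::
  "('v,'e) pre_digraph \<Rightarrow> ('e \<Rightarrow> real) \<Rightarrow> ('v,'e) point set
    \<Rightarrow> (('v,'e) point, 'e \<times> real \<times> real) pre_digraph" where
  "subdivide G l P =
     \<lparr> verts = Vertex ` verts G \<union> P,
       arcs = {(e, a, b). e \<in> arcs G \<and> a \<in> breakpoints l P e \<and> b \<in> breakpoints l P e
                 \<and> a < b \<and> breakpoints l P e \<inter> {a<..<b} = {}},
       tail = (\<lambda>(e, a, b). edge_point G l e a),
       head = (\<lambda>(e, a, b). edge_point G l e b) \<rparr>"

definition eff_resistance ::
  "('v,'e) pre_digraph \<Rightarrow> ('e \<Rightarrow> real) \<Rightarrow> ('v,'e) point \<Rightarrow> ('v,'e) point \<Rightarrow> real" where
  "eff_resistance G l x y =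
     network_resistance (subdivide G l {x, y}) (\<lambda>(e, a, b). b - a) x y"


section \<open>The tau constant\<close>

text \<open>
  The derivative is taken along the parametrization of each edge; it exists except at
  finitely many points, which do not affect the integral.
\<close>

definition tau_at :: "('v,'e) pre_digraph \<Rightarrow> ('e \<Rightarrow> real) \<Rightarrow> ('v,'e) point \<Rightarrow> real" where
  "tau_at G l y =
     1/4 * (\<Sum>e\<in>arcs G. integral {0..l e}
              (\<lambda>t. (deriv (\<lambda>s. eff_resistance G l (edge_point G l e s) y) t)\<^sup>2))"

text \<open>The value does not depend on the base point \<open>y\<close>, so any point may be chosen.\<close>

definition tau :: "('v,'e) pre_digraph \<Rightarrow> ('e \<Rightarrow> real) \<Rightarrow> real" where
  "tau G l = tau_at G l (SOME y. y \<in> points G l)"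

end

theory Submission
  imports Defs "HOL-Combinatorics.Cycles"
begin

text \<open>
  The resistance function \<open>r\<close> is quadratic along each edge, and evaluating the integral gives
  \<open>\<tau> = 1/4 (\<Sum>\<^sub>e (r(p,z) - r(q,z))\<^sup>2 / l\<^sub>e + (l\<^sub>e - r(p,q))\<^sup>2 / (3 l\<^sub>e))\<close>, where \<open>p\<close>, \<open>q\<close> are
  the ends of \<open>e\<close> and \<open>z\<close> is any vertex. Hence \<open>\<tau>\<close> only depends on the resistances between
  vertices, it scales linearly with the lengths, and an edge of length \<open>\<epsilon>\<close> contributes \<open>O(\<epsilon>)\<close>.

  Replace every vertex of valence \<open>d\<close> by a cycle of \<open>d\<close> edges of length \<open>\<epsilon>\<close>, one of the \<open>d\<close> incident
  half-edges being attached at each of its vertices (for \<open>d = 1\<close> the cycle is a loop, for \<open>d = 2\<close> a pair of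
  parallel edges). The result is cubic, and as \<open>\<epsilon> \<rightarrow> 0\<close> its resistances tend to those of \<open>\<Gamma>\<close>,
  so the bound passes to the limit.
\<close>

section \<open>Dirichlet form and potentials\<close>

definition dirichlet ::
  "('a,'b) pre_digraph \<Rightarrow> ('b \<Rightarrow> real) \<Rightarrow> ('a \<Rightarrow> real) \<Rightarrow> ('a \<Rightarrow> real) \<Rightarrow> real" where
  "dirichlet N R f g =
     (\<Sum>e\<in>arcs N. (f (tail N e) - f (head N e)) * (g (tail N e) - g (head N e)) / R e)"

text \<open>Kirchhoff's law in weak form, tested against all functions on the nodes.\<close>

definition is_potential ::
  "('a,'b) pre_digraph \<Rightarrow> ('b \<Rightarrow> real) \<Rightarrow> 'a \<Rightarrow> 'a \<Rightarrow> ('a \<Rightarrow> real) \<Rightarrow> bool" where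
  "is_potential N R u v \<phi> \<longleftrightarrow> (\<forall>f. dirichlet N R \<phi> f = f u - f v)"

lemma dirichlet_commute: "dirichlet N R f g = dirichlet N R g f"
  by (simp add: dirichlet_def mult.commute)

lemma dirichlet_add_left:
  "dirichlet N R (\<lambda>v. f v + g v) h = dirichlet N R f h + dirichlet N R g h"
  unfolding dirichlet_def sum.distrib[symmetric]
  by (intro sum.cong) (auto simp: algebra_simps add_divide_distrib[symmetric] diff_divide_distrib[symmetric])

lemma dirichlet_cmult_left:
  "dirichlet N R (\<lambda>v. c * f v) h = c * dirichlet N R f h"
  unfolding dirichlet_def sum_distrib_left
  by (intro sum.cong) (auto simp: algebra_simps add_divide_distrib[symmetric] diff_divide_distrib[symmetric])

lemma dirichlet_diff_left:
  "dirichlet N R (\<lambda>v. f v - g v) h = dirichlet N R f h - dirichlet N R g h"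
  using dirichlet_add_left[of N R f "\<lambda>v. - 1 * g v" h] dirichlet_cmult_left[of N R "-1" g h] by simp

lemma dirichlet_nonneg:
  "(\<And>e. e \<in> arcs N \<Longrightarrow> R e > 0) \<Longrightarrow> dirichlet N R f f \<ge> 0"
  unfolding dirichlet_def by (intro sum_nonneg divide_nonneg_pos) auto

lemma is_potentialD: "is_potential N R u v \<phi> \<Longrightarrow> dirichlet N R \<phi> f = f u - f v"
  by (simp add: is_potential_def)

lemma is_potential_diff:
  "is_potential N R u w \<phi> \<Longrightarrow> is_potential N R v w \<psi> \<Longrightarrow> is_potential N R u v (\<lambda>x. \<phi> x - \<psi> x)"
  by (simp add: is_potential_def dirichlet_diff_left)

lemma is_potential_refl: "is_potential N R u u (\<lambda>x. 0)"
  by (simp add: is_potential_def dirichlet_def)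

lemma is_potential_sym: "is_potential N R u v \<phi> \<Longrightarrow> is_potential N R v u (\<lambda>x. - \<phi> x)"
  using dirichlet_cmult_left[of N R "- 1" \<phi>] by (simp add: is_potential_def)

lemma is_potential_trans:
  "is_potential N R u v \<phi> \<Longrightarrow> is_potential N R v w \<psi> \<Longrightarrow> is_potential N R u w (\<lambda>x. \<phi> x + \<psi> x)"
  by (simp add: is_potential_def dirichlet_add_left)

lemma dirichlet_insert:
  assumes "finite A" "a \<notin> A"
  shows "dirichlet (N\<lparr>arcs := insert a A\<rparr>) R f g = dirichlet (N\<lparr>arcs := A\<rparr>) R f g
    + (f (tail N a) - f (head N a)) * (g (tail N a) - g (head N a)) / R a"
  using assms by (simp add: dirichlet_def)

text \<open>Adding an arc is a rank-one change of the form: the old potentials are corrected by a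
  multiple of a potential \<open>k\<close> between its ends (Sherman--Morrison). If the ends were not
  connected before, \<open>k\<close> is a multiple of the indicator of the component of the tail.\<close>

lemma ex_potential_arc:
  assumes "finite A" "\<And>e. e \<in> A \<Longrightarrow> R e > 0" "e \<in> A"
  shows "\<exists>\<phi>. is_potential (N\<lparr>arcs := A\<rparr>) R (tail N e) (head N e) \<phi>"
  using assms
proof (induction A arbitrary: e rule: finite_induct)
  case (insert a A)
  let ?D = "dirichlet (N\<lparr>arcs := A\<rparr>) R" and ?D' = "dirichlet (N\<lparr>arcs := insert a A\<rparr>) R"
  let ?p = "tail N a" and ?q = "head N a"
  define rel where "rel u v \<longleftrightarrow> (\<exists>\<phi>. is_potential (N\<lparr>arcs := A\<rparr>) R u v \<phi>)" for u v
  have Ra: "R a > 0" using insert by simp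
  have D': "?D' f g = ?D f g + (f ?p - f ?q) * (g ?p - g ?q) / R a" for f g
    using insert.hyps by (rule dirichlet_insert)
  have IH: "rel (tail N e) (head N e)" if "e \<in> A" for e
    using insert.IH[of e] insert.prems that by (auto simp: rel_def)
  obtain k where k: "?D' k f = f ?p - f ?q" for f
  proof (cases "rel ?p ?q")
    case True
    then obtain k0 where k0: "?D k0 f = f ?p - f ?q" for f
      by (auto simp: rel_def is_potential_def)
    \<comment> \<open>This difference is the energy of \<open>k0\<close>, so the Sherman-Morrison
      denominator in the next line is positive.\<close>
    have "k0 ?p - k0 ?q \<ge> 0"
      using dirichlet_nonneg[of "N\<lparr>arcs := A\<rparr>" R k0] insert.prems by (simp add: k0)
    then have c: "1 + (k0 ?p - k0 ?q) / R a > 0" using Ra by (simp add: add_pos_nonneg)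
    have "?D' (\<lambda>v. inverse (1 + (k0 ?p - k0 ?q) / R a) * k0 v) f = f ?p - f ?q" for f
    proof -
      have "?D' k0 f = (1 + (k0 ?p - k0 ?q) / R a) * (f ?p - f ?q)"
        by (simp add: D' k0 algebra_simps)
      then show ?thesis using c by (simp add: dirichlet_cmult_left)
    qed
    then show ?thesis by (rule that)
  next
    case False
    define k where "k v = R a * of_bool (rel ?p v)" for v
    have rel_trans: "rel u w" if "rel u v" "rel v w" for u v w
      using that by (auto simp: rel_def dest: is_potential_trans)
    have rel_sym: "rel v u" if "rel u v" for u v
      using that by (auto simp: rel_def dest: is_potential_sym)
    \<comment> \<open>By \<open>IH\<close> the ends of an old arc are related, so \<open>k\<close>
      is constant along old arcs and only the new arc sees its jump.\<close>
    have "k (tail N e) = k (head N e)" if "e \<in> A" for e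
    proof -
      have "rel ?p (tail N e) \<longleftrightarrow> rel ?p (head N e)"
        using IH[OF that] rel_trans rel_sym by blast
      then show ?thesis by (simp add: k_def)
    qed
    then have "?D k f = 0" for f
      by (simp add: dirichlet_def)
    moreover have "rel ?p ?p"
      using is_potential_refl by (fastforce simp: rel_def)
    ultimately have "?D' k f = f ?p - f ?q" for f
      using False Ra by (simp add: D' k_def)
    then show ?thesis by (rule that)
  qed
  show ?case
  proof (cases "e = a")
    case True
    then show ?thesis using k by (auto simp: is_potential_def)
  next
    case False
    then have "e \<in> A" using insert.prems by simp
    then obtain \<phi> where \<phi>: "?D \<phi> f = f (tail N e) - f (head N e)" for f
      using IH by (auto simp: rel_def is_potential_def)
    have "?D' (\<lambda>v. \<phi> v - (\<phi> ?p - \<phi> ?q) / R a * k v) f = f (tail N e) - f (head N e)" for f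
      unfolding dirichlet_diff_left dirichlet_cmult_left k by (simp add: D' \<phi>)
    then show ?thesis by (auto simp: is_potential_def)
  qed
qed simp

section \<open>Connectedness through invariant predicates\<close>

text \<open>\<open>connected\<close> means strong connectedness of the symmetric closure; a
  predicate invariant along arcs in both directions propagates along reachability there.\<close>

lemma digraph_connected_induct:
  assumes "wf_digraph G" and conn: "Digraph_Component.connected G"
    and "u \<in> verts G" "P u" "v \<in> verts G"
    and step: "\<And>e. e \<in> arcs G \<Longrightarrow> P (tail G e) \<longleftrightarrow> P (head G e)"
  shows "P v"
proof -
  let ?S = "with_proj (mk_symmetric G)"
  interpret wf_digraph G by fact
  interpret S: wf_digraph ?S
    by unfold_locales (auto simp: mk_symmetric_def)
  have "u \<rightarrow>\<^sup>*\<^bsub>?S\<^esub> v"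
    using assms by (auto simp: Digraph_Component.connected_def strongly_connected_def mk_symmetric_def)
  then show ?thesis using \<open>P u\<close>
  proof (induction rule: S.reachable_induct)
    case (step x y)
    then obtain e where "e \<in> arcs G" "(x = tail G e \<and> y = head G e) \<or> (y = tail G e \<and> x = head G e)"
      by (auto simp: mk_symmetric_def)
    then show ?case using step assms(6) by blast
  qed auto
qed

text \<open>Take for \<open>P\<close> reachability from \<open>u\<close> in the symmetric closure.
  It is invariant along arcs because both orientations of every arc are present.\<close>

lemma digraph_connectedI:
  assumes wf: "wf_digraph G" and "verts G \<noteq> {}"
    and closed: "\<And>P u v. \<lbrakk>\<And>e. e \<in> arcs G \<Longrightarrow> P (tail G e) \<longleftrightarrow> P (head G e);
       u \<in> verts G; P u; v \<in> verts G\<rbrakk> \<Longrightarrow> P v"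
  shows "Digraph_Component.connected G"
proof -
  let ?S = "with_proj (mk_symmetric G)"
  interpret wf_digraph G by (rule wf)
  interpret S: wf_digraph ?S
    by unfold_locales (auto simp: mk_symmetric_def)
  have "u \<rightarrow>\<^sup>*\<^bsub>?S\<^esub> v" if u: "u \<in> verts G" and v: "v \<in> verts G" for u v
  proof (rule closed[where P = "\<lambda>v. u \<rightarrow>\<^sup>*\<^bsub>?S\<^esub> v", OF _ u _ v])
    show "u \<rightarrow>\<^sup>*\<^bsub>?S\<^esub> u"
      using u by (intro S.reachable_refl) (simp add: mk_symmetric_def)
  next
    fix e assume "e \<in> arcs G"
    then have "tail G e \<rightarrow>\<^bsub>?S\<^esub> head G e" "head G e \<rightarrow>\<^bsub>?S\<^esub> tail G e"
      by (auto simp: mk_symmetric_def)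
    then show "u \<rightarrow>\<^sup>*\<^bsub>?S\<^esub> tail G e \<longleftrightarrow> u \<rightarrow>\<^sup>*\<^bsub>?S\<^esub> head G e"
      using S.reachable_adj_trans by blast
  qed
  then show ?thesis using assms(2)
    by (auto simp: Digraph_Component.connected_def strongly_connected_def mk_symmetric_def)
qed

section \<open>Effective resistance in a finite network\<close>

locale network = fin_digraph N for N :: "('a,'b) pre_digraph" +
  fixes R :: "'b \<Rightarrow> real"
  assumes resistance_pos: "e \<in> arcs N \<Longrightarrow> R e > 0"
begin

lemma energy_nonneg: "dirichlet N R f f \<ge> 0"
  using resistance_pos by (rule dirichlet_nonneg)

lemma sum_over_tails: "(\<Sum>v\<in>verts N. \<Sum>e\<in>out_arcs N v. h e) = (\<Sum>e\<in>arcs N. h e)"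
  unfolding out_arcs_def by (rule sum.group) auto

lemma sum_over_heads: "(\<Sum>v\<in>verts N. \<Sum>e\<in>in_arcs N v. h e) = (\<Sum>e\<in>arcs N. h e)"
  unfolding in_arcs_def by (rule sum.group) auto

text \<open>Summation by parts: each arc occurs once at its tail and once at its head, and the two
  contributions combine into the product of the differences.\<close>

lemma dirichlet_eq_sum_net_current:
  "dirichlet N R \<phi> f = (\<Sum>v\<in>verts N. f v *
     ((\<Sum>e\<in>out_arcs N v. (\<phi> v - \<phi> (head N e)) / R e)
      + (\<Sum>e\<in>in_arcs N v. (\<phi> v - \<phi> (tail N e)) / R e)))"
proof -
  have outs: "(\<Sum>v\<in>verts N. f v * (\<Sum>e\<in>out_arcs N v. (\<phi> v - \<phi> (head N e)) / R e))
    = (\<Sum>v\<in>verts N. \<Sum>e\<in>out_arcs N v. f (tail N e) * ((\<phi> (tail N e) - \<phi> (head N e)) / R e))"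
    unfolding sum_distrib_left by (intro sum.cong) auto
  have ins: "(\<Sum>v\<in>verts N. f v * (\<Sum>e\<in>in_arcs N v. (\<phi> v - \<phi> (tail N e)) / R e))
    = (\<Sum>v\<in>verts N. \<Sum>e\<in>in_arcs N v. f (head N e) * ((\<phi> (head N e) - \<phi> (tail N e)) / R e))"
    unfolding sum_distrib_left by (intro sum.cong) auto
  show ?thesis
    unfolding distrib_left sum.distrib outs ins sum_over_tails sum_over_heads
    unfolding dirichlet_def sum.distrib[symmetric]
    by (intro sum.cong)
      (auto simp: algebra_simps add_divide_distrib[symmetric] diff_divide_distrib[symmetric])
qed

text \<open>In one direction Kirchhoff's law is multiplied by \<open>f\<close> and summed over the
  nodes; in the other the weak form is tested with the indicator of a single node.\<close>

lemma unit_current_potential_iff: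
  assumes "x \<in> verts N" "y \<in> verts N"
  shows "unit_current_potential N R x y \<phi> \<longleftrightarrow> is_potential N R x y \<phi>"
proof
  assume "unit_current_potential N R x y \<phi>"
  then have "dirichlet N R \<phi> f = (\<Sum>v\<in>verts N. f v * (of_bool (v = x) - of_bool (v = y)))" for f
    unfolding dirichlet_eq_sum_net_current unit_current_potential_def by (intro sum.cong) auto
  then show "is_potential N R x y \<phi>"
    using assms by (auto simp: is_potential_def right_diff_distrib sum_subtractf of_bool_def
        if_distrib[of "\<lambda>b. _ * b"] cong: if_cong)
next
  assume pot: "is_potential N R x y \<phi>"
  have "(\<Sum>e\<in>out_arcs N w. (\<phi> w - \<phi> (head N e)) / R e)
      + (\<Sum>e\<in>in_arcs N w. (\<phi> w - \<phi> (tail N e)) / R e)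
    = of_bool (w = x) - of_bool (w = y)" (is "?I w = _") if "w \<in> verts N" for w
  proof -
    have "(\<Sum>v\<in>verts N. of_bool (v = w) * ?I v) = of_bool (x = w) - of_bool (y = w)"
      using is_potentialD[OF pot, of "\<lambda>v. of_bool (v = w)"] by (simp add: dirichlet_eq_sum_net_current)
    moreover have "(\<Sum>v\<in>verts N. of_bool (v = w) * ?I v) = (\<Sum>v\<in>verts N. if v = w then ?I v else 0)"
      by (intro sum.cong) auto
    ultimately show ?thesis using that by (simp add: eq_commute)
  qed
  then show "unit_current_potential N R x y \<phi>"
    by (simp add: unit_current_potential_def)
qed

text \<open>The value under \<open>THE\<close> is unique by reciprocity: the pairing of two
  potentials from \<open>x\<close> to \<open>y\<close> equals the voltage of either one, since the
  form is symmetric.\<close>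

lemma network_resistance_eq:
  assumes "x \<in> verts N" "y \<in> verts N" and pot: "is_potential N R x y \<phi>"
  shows "network_resistance N R x y = \<phi> x - \<phi> y"
  unfolding network_resistance_def unit_current_potential_iff[OF assms(1,2)]
proof (rule the_equality)
  fix r assume "\<exists>\<psi>. is_potential N R x y \<psi> \<and> r = \<psi> x - \<psi> y"
  then show "r = \<phi> x - \<phi> y"
    using is_potentialD[OF pot] by (metis dirichlet_commute is_potentialD)
qed (use pot in auto)

end

locale connected_network = network +
  assumes connected: "Digraph_Component.connected N"
begin

lemma ex_potential:
  assumes "u \<in> verts N" "v \<in> verts N"
  shows "\<exists>\<phi>. is_potential N R u v \<phi>"
proof (rule digraph_connected_induct[OF wf_digraph connected \<open>u \<in> verts N\<close> _ \<open>v \<in> verts N\<close>])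
  show "\<exists>\<phi>. is_potential N R u u \<phi>"
    by (rule exI, rule is_potential_refl)
next
  fix e assume "e \<in> arcs N"
  then have "\<exists>\<phi>. is_potential N R (tail N e) (head N e) \<phi>"
    using ex_potential_arc[of "arcs N" R e N] resistance_pos by simp
  then show "(\<exists>\<phi>. is_potential N R u (tail N e) \<phi>) \<longleftrightarrow> (\<exists>\<phi>. is_potential N R u (head N e) \<phi>)"
    by (blast intro: is_potential_trans is_potential_sym)
qed

text \<open>Every summand of the energy is nonnegative, so zero energy means no drop along any arc,
  and connectedness makes \<open>h\<close> constant.\<close>

lemma dirichlet_eq_0D:
  assumes "dirichlet N R h h \<le> 0" "u \<in> verts N" "v \<in> verts N"
  shows "h u = h v"
proof -
  have nn: "(h (tail N e) - h (head N e)) * (h (tail N e) - h (head N e)) / R e \<ge> 0"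
    if "e \<in> arcs N" for e
    using resistance_pos[OF that] by (intro divide_nonneg_pos) auto
  moreover have "dirichlet N R h h = 0"
    using assms(1) energy_nonneg[of h] by linarith
  ultimately have "(h (tail N e) - h (head N e)) * (h (tail N e) - h (head N e)) / R e = 0"
    if "e \<in> arcs N" for e
    unfolding dirichlet_def using that by (subst (asm) sum_nonneg_eq_0_iff) auto
  then have "h (tail N e) = h (head N e)" if "e \<in> arcs N" for e
    using that resistance_pos[OF that] by (metis divide_eq_0_iff eq_iff_diff_eq_0 less_irrefl mult_eq_0_iff)
  then show ?thesis
    using digraph_connected_induct[OF wf_digraph connected assms(2) _ assms(3), of "\<lambda>v. h u = h v"] by simp
qed

text \<open>The maximum principle: truncating the potential does not increase its energy, and the
  potential minimizes the energy among functions with the same difference between \<open>u\<close> and \<open>v\<close>.\<close>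

lemma potential_bounds:
  assumes uv: "u \<in> verts N" "v \<in> verts N" and "w \<in> verts N"
    and pot: "is_potential N R u v \<phi>"
  shows "\<phi> v \<le> \<phi> w" "\<phi> w \<le> \<phi> u"
proof -
  note E = is_potentialD[OF pot]
  define f where "f x = max (\<phi> v) (min (\<phi> u) (\<phi> x))" for x
  define h where "h x = \<phi> x - f x" for x
  have le: "\<phi> v \<le> \<phi> u"
    using energy_nonneg[of \<phi>] by (simp add: E)
  have f: "f u = \<phi> u" "f v = \<phi> v"
    using le by (auto simp: f_def)
  have "dirichlet N R f f \<le> dirichlet N R \<phi> \<phi>"
    unfolding dirichlet_def
  proof (intro sum_mono divide_right_mono)
    fix e assume "e \<in> arcs N"
    show "(f (tail N e) - f (head N e)) * (f (tail N e) - f (head N e))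
      \<le> (\<phi> (tail N e) - \<phi> (head N e)) * (\<phi> (tail N e) - \<phi> (head N e))"
      unfolding abs_le_square_iff[unfolded power2_eq_square, symmetric]
      using le by (auto simp: f_def)
    show "0 \<le> R e" using resistance_pos[OF \<open>e \<in> arcs N\<close>] by simp
  qed
  \<comment> \<open>As \<open>h\<close> vanishes at \<open>u\<close> and \<open>v\<close>, its
    pairing with \<open>\<phi>\<close> is 0; its pairing with \<open>f\<close> is the energy of
    \<open>\<phi>\<close> minus that of \<open>f\<close>, hence nonnegative. So \<open>h\<close> has
    energy at most 0.\<close>
  moreover have "dirichlet N R h h = dirichlet N R \<phi> h - dirichlet N R f h"
    unfolding h_def by (rule dirichlet_diff_left)
  moreover have "dirichlet N R f h = dirichlet N R \<phi> f - dirichlet N R f f"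
    unfolding h_def by (metis dirichlet_commute dirichlet_diff_left)
  ultimately have "dirichlet N R h h \<le> 0"
    by (simp add: E f h_def)
  from dirichlet_eq_0D[OF this \<open>w \<in> verts N\<close> \<open>v \<in> verts N\<close>]
  have "\<phi> w = f w" by (simp add: h_def f)
  then show "\<phi> v \<le> \<phi> w" "\<phi> w \<le> \<phi> u"
    using le by (auto simp: f_def)
qed

text \<open>Superposing currents from \<open>p\<close> to \<open>q\<close> and from \<open>q\<close>
  to \<open>y\<close>, reciprocity gives r(p,y) = r(p,q) + r(q,y) + 2
  (\<open>\<phi> q - \<phi> y\<close>). By the maximum principle the bracket lies between -r(p,q)
  and 0.\<close>

lemma resistance_lipschitz:
  assumes V: "p \<in> verts N" "q \<in> verts N" "y \<in> verts N"
  shows "\<bar>network_resistance N R p y - network_resistance N R q y\<bar> \<le> network_resistance N R p q"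
proof -
  obtain \<phi> \<psi> where pot: "is_potential N R p q \<phi>" "is_potential N R q y \<psi>"
    using ex_potential V by meson
  have "\<psi> p - \<psi> q = \<phi> q - \<phi> y"
    using is_potentialD[OF pot(1), of \<psi>] is_potentialD[OF pot(2), of \<phi>] dirichlet_commute[of N R \<phi> \<psi>]
    by simp
  moreover have "network_resistance N R p y = (\<phi> p + \<psi> p) - (\<phi> y + \<psi> y)"
    using network_resistance_eq[OF _ _ is_potential_trans[OF pot]] V by simp
  ultimately show ?thesis
    using network_resistance_eq[OF _ _ pot(1)] network_resistance_eq[OF _ _ pot(2)] V
      potential_bounds[OF _ _ _ pot(1)] by (smt (verit))
qed

lemma resistance_nonneg:
  assumes "u \<in> verts N" "v \<in> verts N"
  shows "network_resistance N R u v \<ge> 0"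
proof -
  obtain \<phi> where "is_potential N R u v \<phi>"
    using ex_potential assms by meson
  then show ?thesis
    using network_resistance_eq assms potential_bounds(1) by fastforce
qed

text \<open>The energy of the potential equals the resistance r and is at least the share of the
  single arc \<open>e\<close>, so r^2 / \<open>R e\<close> is at most r.\<close>

lemma resistance_arc_le:
  assumes e: "e \<in> arcs N"
  shows "network_resistance N R (tail N e) (head N e) \<le> R e" (is "?r \<le> _")
proof -
  obtain \<phi> where pot: "is_potential N R (tail N e) (head N e) \<phi>"
    using ex_potential e by (meson head_in_verts tail_in_verts)
  have r: "?r = \<phi> (tail N e) - \<phi> (head N e)"
    using network_resistance_eq[OF _ _ pot] e by simp
  have Re: "R e > 0" using resistance_pos e by simp
  have "(\<phi> (tail N e) - \<phi> (head N e)) * (\<phi> (tail N e) - \<phi> (head N e)) / R e \<le> dirichlet N R \<phi> \<phi>"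
    unfolding dirichlet_def using e finite_arcs
    by (intro member_le_sum[where f = "\<lambda>e. (\<phi> (tail N e) - \<phi> (head N e)) * (\<phi> (tail N e) - \<phi> (head N e)) / R e"])
      (auto intro!: divide_nonneg_pos resistance_pos)
  then have "?r * ?r \<le> R e * ?r"
    using is_potentialD[OF pot, of \<phi>] Re by (simp add: r field_simps)
  then show ?thesis
    using Re resistance_nonneg[of "tail N e" "head N e"] e
    by (metis head_in_verts mult_right_le_imp_le not_le order_less_le_trans less_le_not_le tail_in_verts)
qed

text \<open>No arc carries more than the unit current: by reciprocity the drop along
  \<open>e\<close> is a difference of values of the potential \<open>\<psi>\<close> between the ends
  of \<open>e\<close>, whose oscillation is at most \<open>R e\<close>.\<close>

lemma potential_drop_le:
  assumes "u \<in> verts N" "v \<in> verts N" and pot: "is_potential N R u v \<phi>" and e: "e \<in> arcs N"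
  shows "\<bar>\<phi> (tail N e) - \<phi> (head N e)\<bar> \<le> R e"
proof -
  obtain \<psi> where \<psi>: "is_potential N R (tail N e) (head N e) \<psi>"
    using ex_potential e by (meson head_in_verts tail_in_verts)
  have "\<phi> (tail N e) - \<phi> (head N e) = \<psi> u - \<psi> v"
    using is_potentialD[OF pot, of \<psi>] is_potentialD[OF \<psi>, of \<phi>] dirichlet_commute[of N R \<phi> \<psi>]
    by simp
  moreover have "\<psi> (tail N e) - \<psi> (head N e) \<le> R e"
    using resistance_arc_le[OF e] network_resistance_eq[OF _ _ \<psi>] e by simp
  ultimately show ?thesis
    using potential_bounds[OF _ _ \<open>u \<in> verts N\<close> \<psi>] potential_bounds[OF _ _ \<open>v \<in> verts N\<close> \<psi>] e
    by simp
qed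

end

section \<open>Green functions of a network\<close>

text \<open>\<open>g\<close> is the Green function grounded at \<open>z\<close>, the reproducing
  kernel of the Dirichlet form on functions vanishing at \<open>z\<close>.\<close>

locale green_function = connected_network +
  fixes z :: 'a and g :: "'a \<Rightarrow> 'a \<Rightarrow> real"
  assumes base_in_verts: "z \<in> verts N"
    and is_potential_green: "v \<in> verts N \<Longrightarrow> is_potential N R v z (g v)"
    and green_base: "v \<in> verts N \<Longrightarrow> g v z = 0"
begin

lemma dirichlet_green: "v \<in> verts N \<Longrightarrow> dirichlet N R (g v) f = f v - f z"
  using is_potentialD is_potential_green by metis

lemma green_commute: "v \<in> verts N \<Longrightarrow> w \<in> verts N \<Longrightarrow> g v w = g w v"
  using dirichlet_green[of v "g w"] dirichlet_green[of w "g v"] dirichlet_commute[of N R "g v" "g w"]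
    green_base by simp

lemma green_base_left: "v \<in> verts N \<Longrightarrow> g z v = 0"
  using green_commute[of z v] green_base base_in_verts by simp

lemma resistance_green:
  "v \<in> verts N \<Longrightarrow> w \<in> verts N \<Longrightarrow> network_resistance N R v w = g v v + g w w - 2 * g v w"
  using network_resistance_eq[OF _ _ is_potential_diff[OF is_potential_green is_potential_green], of v w]
    green_commute[of v w] by simp

lemma resistance_green_base:
  "v \<in> verts N \<Longrightarrow> network_resistance N R v z = g v v"
  using resistance_green[of v z] green_base green_base_left base_in_verts by simp

end

lemma (in connected_network) ex_green:
  assumes "z \<in> verts N"
  shows "\<exists>g. green_function N R z g"
proof -
  have "\<forall>v\<in>verts N. \<exists>\<phi>. is_potential N R v z \<phi>"
    using ex_potential assms by blast
  then obtain \<phi> where \<phi>: "is_potential N R v z (\<phi> v)" if "v \<in> verts N" for v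
    using bchoice[of "verts N" "\<lambda>v \<phi>. is_potential N R v z \<phi>"] by blast
  have "is_potential N R v z (\<lambda>x. \<phi> v x - \<phi> v z)" if "v \<in> verts N" for v
    using \<phi>[OF that] unfolding is_potential_def dirichlet_def by simp
  then have "green_function N R z (\<lambda>v x. \<phi> v x - \<phi> v z)"
    using assms by unfold_locales auto
  then show ?thesis by blast
qed

section \<open>Resistance between points of a metrized graph\<close>

definition segments :: "real set \<Rightarrow> (real \<times> real) set" where
  "segments T = {(a, b). a \<in> T \<and> b \<in> T \<and> a < b \<and> T \<inter> {a<..<b} = {}}"

lemma finite_segments: "finite T \<Longrightarrow> finite (segments T)"
  by (rule finite_subset[of _ "T \<times> T"]) (auto simp: segments_def)

lemma sum_segments_telescope:
  fixes f :: "real \<Rightarrow> real"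
  assumes "finite T" "T \<noteq> {}"
  shows "(\<Sum>(a, b)\<in>segments T. f b - f a) = f (Max T) - f (Min T)"
  using assms
proof (induction T rule: finite_linorder_max_induct)
  case (insert m T)
  show ?case
  proof (cases "T = {}")
    case True
    then have "segments (insert m T) = {}" by (auto simp: segments_def)
    then show ?thesis using True by simp
  next
    case False
    have Max: "Max T \<in> T" "\<And>t. t \<in> T \<Longrightarrow> t \<le> Max T"
      using insert False by auto
    \<comment> \<open>A new maximum creates exactly one consecutive pair and destroys none.\<close>
    have "segments (insert m T) = insert (Max T, m) (segments T)"
    proof (intro equalityI subsetI)
      fix c assume c: "c \<in> segments (insert m T)"
      obtain a b where ab: "c = (a, b)" by (cases c)
      show "c \<in> insert (Max T, m) (segments T)"
      proof (cases "b = m")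
        case True
        have "a \<in> T" using c insert.hyps(2) by (auto simp: segments_def ab)
        moreover have "\<not> a < Max T"
          using c Max(1) insert.hyps(2) True by (auto simp: segments_def ab)
        ultimately show ?thesis using Max True by (force simp: ab)
      next
        case False
        then show ?thesis using c insert.hyps(2) by (force simp: segments_def ab)
      qed
    next
      fix c assume "c \<in> insert (Max T, m) (segments T)"
      then show "c \<in> segments (insert m T)"
        using Max insert.hyps(2) by (fastforce simp: segments_def)
    qed
    moreover have "(Max T, m) \<notin> segments T"
      using insert.hyps(2) by (auto simp: segments_def)
    moreover have "Max (insert m T) = m"
      using insert.hyps by (intro Max_eqI) (auto simp: less_imp_le)
    moreover have "Min T < m"
      using insert.hyps False by simp
    then have "Min (insert m T) = Min T"
      using Min_insert[OF insert.hyps(1) False, of m] by linarith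
    ultimately show ?thesis
      using insert finite_segments[of T] False by simp
  qed
qed simp

text \<open>Since the kink \<open>s\<close> belongs to \<open>T\<close>, no segment straddles it. On
  either side the slope cancels the denominator, and the increments of \<open>f\<close>
  telescope.\<close>

lemma sum_segments_piecewise_linear:
  fixes F f :: "real \<Rightarrow> real"
  assumes T: "finite T" "Min T = c" "Max T = d" "s \<in> T"
    and left: "\<And>a b. a \<in> T \<Longrightarrow> b \<in> T \<Longrightarrow> a < b \<Longrightarrow> b \<le> s \<Longrightarrow> F b - F a = \<alpha> * (b - a)"
    and right: "\<And>a b. a \<in> T \<Longrightarrow> b \<in> T \<Longrightarrow> a < b \<Longrightarrow> s \<le> a \<Longrightarrow> F b - F a = \<beta> * (b - a)"
  shows "(\<Sum>(a, b)\<in>segments T. (F a - F b) * (f a - f b) / (b - a))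
    = \<alpha> * (f s - f c) + \<beta> * (f d - f s)"
proof -
  let ?L = "T \<inter> {..s}" and ?R = "T \<inter> {s..}"
  let ?h = "\<lambda>(a, b). (F a - F b) * (f a - f b) / (b - a)"
  have split: "segments T = segments ?L \<union> segments ?R"
    using T(4) by (auto simp: segments_def)
  have disj: "segments ?L \<inter> segments ?R = {}"
    by (auto simp: segments_def)
  have "sum ?h (segments T) = sum ?h (segments ?L) + sum ?h (segments ?R)"
    unfolding split using T(1) disj by (intro sum.union_disjoint finite_segments) auto
  also have "sum ?h (segments ?L) = (\<Sum>(a, b)\<in>segments ?L. \<alpha> * f b - \<alpha> * f a)"
  proof (intro sum.cong refl)
    fix p assume "p \<in> segments ?L"
    then obtain a b where p: "p = (a, b)" "a \<in> T" "b \<in> T" "a < b" "b \<le> s"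
      by (auto simp: segments_def)
    have "F a - F b = - (\<alpha> * (b - a))" using left[OF p(2-5)] by simp
    then have "?h p = - (\<alpha> * (b - a)) * (f a - f b) / (b - a)"
      by (simp add: p)
    then show "?h p = (case p of (a, b) \<Rightarrow> \<alpha> * f b - \<alpha> * f a)"
      using p by (simp add: field_simps)
  qed
  also have "\<dots> = \<alpha> * f (Max ?L) - \<alpha> * f (Min ?L)"
    using T by (intro sum_segments_telescope[where f = "\<lambda>x. \<alpha> * f x"]) auto
  also have "sum ?h (segments ?R) = (\<Sum>(a, b)\<in>segments ?R. \<beta> * f b - \<beta> * f a)"
  proof (intro sum.cong refl)
    fix p assume "p \<in> segments ?R"
    then obtain a b where p: "p = (a, b)" "a \<in> T" "b \<in> T" "a < b" "s \<le> a"
      by (auto simp: segments_def)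
    have "F a - F b = - (\<beta> * (b - a))" using right[OF p(2-5)] by simp
    then have "?h p = - (\<beta> * (b - a)) * (f a - f b) / (b - a)"
      by (simp add: p)
    then show "?h p = (case p of (a, b) \<Rightarrow> \<beta> * f b - \<beta> * f a)"
      using p by (simp add: field_simps)
  qed
  also have "\<dots> = \<beta> * f (Max ?R) - \<beta> * f (Min ?R)"
    using T by (intro sum_segments_telescope[where f = "\<lambda>x. \<beta> * f x"]) auto
  also have "Max ?L = s" "Min ?R = s"
    using T by (auto intro!: Max_eqI Min_eqI)
  moreover have "Min ?L = c"
    using T Min_in[of T] by (intro Min_eqI) (auto simp: Min_le)
  moreover have "Max ?R = d"
    using T Max_in[of T] by (intro Max_eqI) (auto simp: Max_ge)
  ultimately show ?thesis by (simp add: algebra_simps)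
qed

section \<open>The Dirichlet form of a subdivided graph\<close>

sublocale metrized_graph \<subseteq> network G l
  by unfold_locales (rule length_pos)

sublocale metrized_graph \<subseteq> connected_network G l
  by unfold_locales (rule connected)

context metrized_graph
begin

lemma finite_breakpoints: "finite P \<Longrightarrow> finite (breakpoints l P e)"
proof -
  assume "finite P"
  moreover have "inj_on (Inner e) A" for A :: "real set"
    by (auto simp: inj_on_def)
  ultimately have "finite (Inner e -` P)"
    by (intro finite_vimageI) auto
  moreover have "{t. Inner e t \<in> P} = Inner e -` P" by auto
  ultimately show ?thesis by (simp add: breakpoints_def)
qed

lemma arcs_subdivide: "arcs (subdivide G l P) = Sigma (arcs G) (\<lambda>e. segments (breakpoints l P e))"
  by (auto simp: subdivide_def segments_def)

lemma breakpoints_bounds: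
  assumes "P \<subseteq> points G l" "e \<in> arcs G" "t \<in> breakpoints l P e"
  shows "0 \<le> t" "t \<le> l e"
  using assms length_pos[OF assms(2)] by (auto simp: breakpoints_def points_def)

lemma network_subdivide:
  assumes P: "finite P" "P \<subseteq> points G l"
  shows "network (subdivide G l P) (\<lambda>(e, a, b). b - a)"
proof unfold_locales
  have *: "edge_point G l e t \<in> verts (subdivide G l P)" if "e \<in> arcs G" "t \<in> breakpoints l P e" for e t
    using that length_pos[of e] by (auto simp: edge_point_def subdivide_def breakpoints_def)
  fix x assume "x \<in> arcs (subdivide G l P)"
  then obtain e a b where x: "x = (e, a, b)" "e \<in> arcs G" "a \<in> breakpoints l P e" "b \<in> breakpoints l P e" "a < b"
    by (auto simp: arcs_subdivide segments_def)
  show "tail (subdivide G l P) x \<in> verts (subdivide G l P)"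
    using *[OF x(2,3)] by (simp add: x subdivide_def)
  show "head (subdivide G l P) x \<in> verts (subdivide G l P)"
    using *[OF x(2,4)] by (simp add: x subdivide_def)
  show "(case x of (e, a, b) \<Rightarrow> b - a) > 0" using x by simp
next
  show "finite (verts (subdivide G l P))"
    using P by (simp add: subdivide_def)
  show "finite (arcs (subdivide G l P))"
    using finite_breakpoints[OF P(1)] by (simp add: arcs_subdivide finite_segments)
qed

lemma dirichlet_subdivide:
  assumes P: "finite P"
  shows "dirichlet (subdivide G l P) (\<lambda>(e, a, b). b - a) F f =
    (\<Sum>e\<in>arcs G. \<Sum>(a, b)\<in>segments (breakpoints l P e).
       (F (edge_point G l e a) - F (edge_point G l e b)) *
       (f (edge_point G l e a) - f (edge_point G l e b)) / (b - a))"
proof -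
  have "dirichlet (subdivide G l P) (\<lambda>(e, a, b). b - a) F f =
    (\<Sum>(e, a, b)\<in>Sigma (arcs G) (\<lambda>e. segments (breakpoints l P e)).
       (F (edge_point G l e a) - F (edge_point G l e b)) *
       (f (edge_point G l e a) - f (edge_point G l e b)) / (b - a))"
    unfolding dirichlet_def arcs_subdivide by (intro sum.cong) (auto simp: subdivide_def)
  then show ?thesis
    using finite_breakpoints[OF P] by (simp add: sum.Sigma finite_segments)
qed

text \<open>The test function \<open>f\<close> is arbitrary at the breakpoints; only its values at
  the two ends and at the kink of \<open>F\<close> survive.\<close>

lemma segments_edge:
  assumes P: "finite P" "P \<subseteq> points G l" and e: "e \<in> arcs G" and s: "s \<in> breakpoints l P e"
    and left: "\<And>t. 0 \<le> t \<Longrightarrow> t \<le> s \<Longrightarrow> F (edge_point G l e t) = \<alpha> * t + c"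
    and right: "\<And>t. s \<le> t \<Longrightarrow> t \<le> l e \<Longrightarrow> F (edge_point G l e t) = \<beta> * t + d"
  shows "(\<Sum>(a, b)\<in>segments (breakpoints l P e).
       (F (edge_point G l e a) - F (edge_point G l e b)) *
       (f (edge_point G l e a) - f (edge_point G l e b)) / (b - a))
     = \<alpha> * (f (edge_point G l e s) - f (Vertex (tail G e)))
       + \<beta> * (f (Vertex (head G e)) - f (edge_point G l e s))"
proof -
  let ?T = "breakpoints l P e"
  note b = breakpoints_bounds[OF P(2) e]
  have len: "l e > 0" by (rule length_pos[OF e])
  have fin: "finite ?T" and ends: "0 \<in> ?T" "l e \<in> ?T"
    using finite_breakpoints[OF P(1)] by (auto simp: breakpoints_def)
  have T: "finite ?T" "Min ?T = 0" "Max ?T = l e"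
    using fin Min_eqI[OF fin b(1) ends(1)] Max_eqI[OF fin b(2) ends(2)] by auto
  have "(\<Sum>(a, b)\<in>segments ?T.
       (F (edge_point G l e a) - F (edge_point G l e b)) *
       (f (edge_point G l e a) - f (edge_point G l e b)) / (b - a))
     = \<alpha> * (f (edge_point G l e s) - f (edge_point G l e 0))
       + \<beta> * (f (edge_point G l e (l e)) - f (edge_point G l e s))"
  proof (rule sum_segments_piecewise_linear[OF T s,
        where F = "\<lambda>t. F (edge_point G l e t)" and f = "\<lambda>t. f (edge_point G l e t)"])
    fix a b' assume "a \<in> ?T" "b' \<in> ?T" "a < b'"
    then have bd: "0 \<le> a" "a \<le> l e" "0 \<le> b'" "b' \<le> l e" using b by auto
    { assume "b' \<le> s"
      then show "F (edge_point G l e b') - F (edge_point G l e a) = \<alpha> * (b' - a)"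
        using bd \<open>a < b'\<close> by (simp add: left algebra_simps) }
    { assume "s \<le> a"
      then show "F (edge_point G l e b') - F (edge_point G l e a) = \<beta> * (b' - a)"
        using bd \<open>a < b'\<close> by (simp add: right algebra_simps) }
  qed
  then show ?thesis using len by (simp add: edge_point_def)
qed

end


section \<open>The Green function at arbitrary points\<close>

locale metrized_green = metrized_graph G l + green_function G l z g for G l z g
begin

text \<open>
  The function \<open>\<lambda>x. point_green x y\<close> is the potential of a unit current from the point \<open>y\<close> to
  \<open>z\<close>: the current first splits on the edge of \<open>y\<close>, whose ends are held at potential 0 (this
  potential is the Dirichlet Green function \<open>bubble\<close> of the edge), and then enters the network
  at the ends of the edge in the proportions of the linear interpolation.
\<close>

primrec interpolate :: "('a \<Rightarrow> real) \<Rightarrow> ('a, 'b) point \<Rightarrow> real" where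
  "interpolate h (Vertex v) = h v"
| "interpolate h (Inner e s) = (1 - s / l e) * h (tail G e) + s / l e * h (head G e)"

fun bubble :: "('a, 'b) point \<Rightarrow> ('a, 'b) point \<Rightarrow> real" where
  "bubble (Inner e s) (Inner e' u) = (if e = e' then min s u - s * u / l e else 0)"
| "bubble _ _ = 0"

definition point_green :: "('a, 'b) point \<Rightarrow> ('a, 'b) point \<Rightarrow> real" where
  "point_green x y = interpolate (\<lambda>v. interpolate (\<lambda>w. g w v) y) x + bubble x y"

lemma interpolate_edge_point:
  assumes "e \<in> arcs G" "0 \<le> t" "t \<le> l e"
  shows "interpolate h (edge_point G l e t) = (h (head G e) - h (tail G e)) / l e * t + h (tail G e)"
  using assms length_pos[of e] by (auto simp: edge_point_def field_simps)

lemma bubble_edge_point: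
  assumes "e \<in> arcs G" "0 \<le> t" "t \<le> l e" "0 < u" "u < l e'"
  shows "bubble (edge_point G l e t) (Inner e' u) = (if e = e' then min t u - t * u / l e else 0)"
  using assms length_pos[of e] by (auto simp: edge_point_def)

lemma bubble_Vertex [simp]: "bubble x (Vertex v) = 0"
  by (cases x) auto

lemma dirichlet_interpolate_green:
  assumes "y \<in> points G l"
  shows "dirichlet G l (\<lambda>v. interpolate (\<lambda>w. g w v) y) f = interpolate f y - f z"
proof (cases y)
  case (Vertex v)
  then show ?thesis using assms by (auto simp: points_def dirichlet_green)
next
  case (Inner e t)
  then have e: "tail G e \<in> verts G" "head G e \<in> verts G"
    using assms by (auto simp: points_def)
  show ?thesis
    unfolding Inner interpolate.simps dirichlet_add_left dirichlet_cmult_left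
    by (simp add: dirichlet_green e algebra_simps)
qed

text \<open>Along \<open>e\<close> the kernel is the linear interpolation of \<open>h\<close> plus
  the bubble. The linear part reproduces the term of \<open>e\<close> in the form of
  \<open>G\<close>; the bubble, whose slope falls by 1 at \<open>y\<close>, yields
  \<open>f y\<close> minus the interpolated value.\<close>

lemma sum_segments_point_green:
  assumes P: "finite P" "P \<subseteq> points G l" "y \<in> P" and e: "e \<in> arcs G"
  defines "h \<equiv> \<lambda>v. interpolate (\<lambda>w. g w v) y"
  shows "(\<Sum>(a, b)\<in>segments (breakpoints l P e).
       (point_green (edge_point G l e a) y - point_green (edge_point G l e b) y) *
       (f (edge_point G l e a) - f (edge_point G l e b)) / (b - a))
     = (h (tail G e) - h (head G e)) * (f (Vertex (tail G e)) - f (Vertex (head G e))) / l e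
       + (case y of Vertex v \<Rightarrow> 0 | Inner e' u \<Rightarrow>
           if e' = e then f y - interpolate (\<lambda>v. f (Vertex v)) y else 0)"
proof -
  let ?p = "tail G e" and ?q = "head G e"
  have len: "l e > 0" by (rule length_pos[OF e])
  have K: "point_green (edge_point G l e t) y = (h ?q - h ?p) / l e * t + h ?p + bubble (edge_point G l e t) y"
    if "0 \<le> t" "t \<le> l e" for t
    using that e by (simp add: point_green_def interpolate_edge_point h_def)
  show ?thesis
  proof (cases "\<exists>u. y = Inner e u")
    case True
    then obtain u where y: "y = Inner e u" by blast
    then have u: "0 < u" "u < l e" "u \<in> breakpoints l P e"
      using P by (auto simp: points_def breakpoints_def)
    have K: "point_green (edge_point G l e t) y = (h ?q - h ?p) / l e * t + h ?p + (min t u - t * u / l e)"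
      if "0 \<le> t" "t \<le> l e" for t
      unfolding K[OF that] using that e u by (simp add: y bubble_edge_point)
    have "(\<Sum>(a, b)\<in>segments (breakpoints l P e).
       (point_green (edge_point G l e a) y - point_green (edge_point G l e b) y) *
       (f (edge_point G l e a) - f (edge_point G l e b)) / (b - a))
       = ((h ?q - h ?p) / l e + 1 - u / l e) * (f (edge_point G l e u) - f (Vertex ?p))
       + ((h ?q - h ?p) / l e - u / l e) * (f (Vertex ?q) - f (edge_point G l e u))"
      using u by (intro segments_edge[OF P(1,2) e u(3), where c = "h ?p" and d = "h ?p + u"])
        (auto simp: K algebra_simps)
    also have "edge_point G l e u = y"
      using u by (simp add: y edge_point_def)
    also have "((h ?q - h ?p) / l e + 1 - u / l e) * (f y - f (Vertex ?p))
       + ((h ?q - h ?p) / l e - u / l e) * (f (Vertex ?q) - f y)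
       = (h ?p - h ?q) * (f (Vertex ?p) - f (Vertex ?q)) / l e
         + (f y - interpolate (\<lambda>v. f (Vertex v)) y)"
      using len by (simp add: y field_simps)
    finally show ?thesis by (simp add: y)
  next
    case False
    have K: "point_green (edge_point G l e t) y = (h ?q - h ?p) / l e * t + h ?p"
      if "0 \<le> t" "t \<le> l e" for t
      unfolding K[OF that] using that e False P by (cases y) (auto simp: bubble_edge_point points_def)
    \<comment> \<open>Without a kink on \<open>e\<close>, the break is placed at the end 0, where
      the left piece is degenerate.\<close>
    have "(\<Sum>(a, b)\<in>segments (breakpoints l P e).
       (point_green (edge_point G l e a) y - point_green (edge_point G l e b) y) *
       (f (edge_point G l e a) - f (edge_point G l e b)) / (b - a))
       = (h ?q - h ?p) / l e * (f (edge_point G l e 0) - f (Vertex ?p))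
       + (h ?q - h ?p) / l e * (f (Vertex ?q) - f (edge_point G l e 0))"
      by (intro segments_edge[OF P(1,2) e, where c = "h ?p" and d = "h ?p"])
        (use len in \<open>auto simp: K breakpoints_def\<close>)
    then show ?thesis
      using False len by (auto simp: edge_point_def field_simps split: point.split)
  qed
qed

text \<open>Summed over the edges, the linear parts give the interpolation of \<open>f\<close> at
  \<open>y\<close> minus \<open>f (Vertex z)\<close>, and the bubble restores \<open>f y\<close> in
  place of the interpolation.\<close>

lemma is_potential_point_green:
  assumes P: "finite P" "P \<subseteq> points G l" "y \<in> P"
  shows "is_potential (subdivide G l P) (\<lambda>(e, a, b). b - a) y (Vertex z) (\<lambda>x. point_green x y)"
  unfolding is_potential_def
proof
  fix f :: "('a, 'b) point \<Rightarrow> real"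
  let ?f = "\<lambda>v. f (Vertex v)"
  have "y \<in> points G l" using P by auto
  then have "(\<Sum>e\<in>arcs G. case y of Vertex v \<Rightarrow> 0 | Inner e' u \<Rightarrow>
      if e' = e then f y - interpolate ?f y else 0) = f y - interpolate ?f y"
    by (auto simp: points_def)
  then show "dirichlet (subdivide G l P) (\<lambda>(e, a, b). b - a) (\<lambda>x. point_green x y) f = f y - f (Vertex z)"
    using sum_segments_point_green[OF P] dirichlet_interpolate_green[OF \<open>y \<in> points G l\<close>, of ?f]
    unfolding dirichlet_subdivide[OF P(1)] by (simp add: sum.distrib dirichlet_def)
qed

lemma point_green_base [simp]: "y \<in> points G l \<Longrightarrow> point_green (Vertex z) y = 0"
  by (auto simp: point_green_def points_def green_base)

lemma eff_resistance_point_green: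
  assumes xy: "x \<in> points G l" "y \<in> points G l"
  shows "eff_resistance G l x y = point_green x x + point_green y y - 2 * point_green x y"
proof -
  let ?P = "{x, y}"
  have P: "finite ?P" "?P \<subseteq> points G l" using xy by auto
  interpret S: network "subdivide G l ?P" "\<lambda>(e, a, b). b - a"
    by (rule network_subdivide[OF P])
  note pot = is_potential_point_green[OF P]
  have "point_green x y = point_green y x"
    using is_potentialD[OF pot[of x], of "\<lambda>u. point_green u y"] is_potentialD[OF pot[of y], of "\<lambda>u. point_green u x"]
      dirichlet_commute[of "subdivide G l ?P" _ "\<lambda>u. point_green u x" "\<lambda>u. point_green u y"] xy
    by simp
  then show ?thesis
    using S.network_resistance_eq[OF _ _ is_potential_diff[OF pot[of x] pot[of y]]]
    by (simp add: eff_resistance_def subdivide_def)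
qed

end

text \<open>The formula for \<open>f\<close> is only assumed inside the interval: at the ends
  \<open>deriv f\<close> may be any value, as at the kinks of the resistance function, and a finite
  set does not affect the integral.\<close>

lemma has_integral_deriv_square_quadratic:
  fixes f :: "real \<Rightarrow> real"
  assumes "a \<le> b" and f: "\<And>s. a < s \<Longrightarrow> s < b \<Longrightarrow> f s = c0 + c1 * s + c2 * s\<^sup>2"
  shows "((\<lambda>t. (deriv f t)\<^sup>2) has_integral
    (c1\<^sup>2 * (b - a) + 2 * c1 * c2 * (b\<^sup>2 - a\<^sup>2) + 4 / 3 * c2\<^sup>2 * (b ^ 3 - a ^ 3))) {a..b}"
proof -
  let ?F = "\<lambda>t. c1\<^sup>2 * t + 2 * c1 * c2 * t\<^sup>2 + 4 / 3 * c2\<^sup>2 * t ^ 3"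
  have int: "((\<lambda>t. (c1 + 2 * c2 * t)\<^sup>2) has_integral (?F b - ?F a)) {a..b}"
    using assms(1)
  proof (rule fundamental_theorem_of_calculus)
    fix t
    have "(?F has_real_derivative (c1 + 2 * c2 * t)\<^sup>2) (at t within {a..b})"
      by (auto intro!: derivative_eq_intros simp: power2_eq_square algebra_simps)
    then show "(?F has_vector_derivative (c1 + 2 * c2 * t)\<^sup>2) (at t within {a..b})"
      by (simp add: has_real_derivative_iff_has_vector_derivative)
  qed
  have deriv: "(deriv f t)\<^sup>2 = (c1 + 2 * c2 * t)\<^sup>2" if "t \<in> {a..b} - {a, b}" for t
  proof -
    have "((\<lambda>s. c0 + c1 * s + c2 * s\<^sup>2) has_real_derivative c1 + 2 * c2 * t) (at t)"
      by (auto intro!: derivative_eq_intros)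
    then have "(f has_real_derivative c1 + 2 * c2 * t) (at t)"
      by (rule has_field_derivative_transform_within_open[where S = "{a<..<b}"]) (use that f in auto)
    then show ?thesis by (simp add: DERIV_imp_deriv)
  qed
  have "((\<lambda>t. (deriv f t)\<^sup>2) has_integral (?F b - ?F a)) {a..b}"
    by (rule has_integral_spike_finite[where S = "{a, b}", OF _ deriv int]) auto
  moreover have "?F b - ?F a =
      c1\<^sup>2 * (b - a) + 2 * c1 * c2 * (b\<^sup>2 - a\<^sup>2) + 4 / 3 * c2\<^sup>2 * (b ^ 3 - a ^ 3)"
    by (simp add: right_diff_distrib)
  ultimately show ?thesis by simp
qed

section \<open>A formula for the tau constant\<close>

context metrized_green
begin

text \<open>
  The excess on the edge that contains the base point \<open>y\<close> in its interior. In the sum over all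
  edges it is cancelled by the change of the energy of the vertex values of \<open>r(\<cdot>, y)\<close>, which is
  why \<open>\<tau>\<close> does not depend on \<open>y\<close>.
\<close>

definition step_energy :: "'b \<Rightarrow> ('a, 'b) point \<Rightarrow> real" where
  "step_energy e y = (case y of Vertex v \<Rightarrow> 0 | Inner e' u \<Rightarrow> if e' = e then
     4 * (u / l e) * (1 - u / l e) * (g (tail G e) (tail G e) + g (head G e) (head G e)
       - 2 * g (tail G e) (head G e)) else 0)"

text \<open>Here \<open>r\<close> gives the resistances from the vertices to \<open>y\<close>, and
  \<open>\<rho>\<close> is the resistance between the ends of \<open>e\<close>. Along
  \<open>e\<close> the resistance to \<open>y\<close> is a parabola, with a kink if \<open>y\<close>
  lies inside \<open>e\<close>.\<close>

lemma integral_deriv_eff_resistance: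
  assumes y: "y \<in> points G l" and e: "e \<in> arcs G"
  defines "r \<equiv> \<lambda>v. g v v + point_green y y - 2 * interpolate (\<lambda>w. g w v) y"
    and "\<rho> \<equiv> g (tail G e) (tail G e) + g (head G e) (head G e) - 2 * g (tail G e) (head G e)"
  shows "integral {0..l e} (\<lambda>t. (deriv (\<lambda>s. eff_resistance G l (edge_point G l e s) y) t)\<^sup>2)
    = (r (tail G e) - r (head G e))\<^sup>2 / l e + (l e - \<rho>)\<^sup>2 / (3 * l e) + step_energy e y"
proof -
  let ?p = "tail G e" and ?q = "head G e" and ?L = "l e"
  let ?R = "\<lambda>s. eff_resistance G l (edge_point G l e s) y"
  have len: "?L > 0" by (rule length_pos[OF e])
  \<comment> \<open>\<open>D\<close> is the slope of the chord and \<open>-\<kappa>\<close> the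
    quadratic coefficient of the parabola.\<close>
  define D where "D = (r ?q - r ?p) / ?L"
  define \<kappa> where "\<kappa> = (1 - \<rho> / ?L) / ?L"
  have D: "r ?q = r ?p + D * ?L" using len by (simp add: D_def)
  have \<rho>: "\<rho> = ?L - \<kappa> * ?L\<^sup>2"
    using len by (simp add: \<kappa>_def power2_eq_square field_simps)
  have R: "?R s = r ?p + D * s + \<kappa> * (s * (?L - s)) - 2 * bubble (Inner e s) y"
    if s: "0 < s" "s < ?L" for s
  proof -
    have "edge_point G l e s = Inner e s" "Inner e s \<in> points G l"
      using s e by (auto simp: edge_point_def points_def)
    then have "?R s = point_green (Inner e s) (Inner e s) + point_green y y - 2 * point_green (Inner e s) y"
      using eff_resistance_point_green y by simp
    also have "\<dots> = (1 - s / ?L) * r ?p + s / ?L * r ?q + s - s\<^sup>2 / ?L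
        - s / ?L * (1 - s / ?L) * \<rho> - 2 * bubble (Inner e s) y"
      using green_commute[of ?p ?q] e len
      by (simp add: point_green_def r_def \<rho>_def power2_eq_square field_simps)
    also have "\<dots> = r ?p + D * s + \<kappa> * (s * (?L - s)) - 2 * bubble (Inner e s) y"
      unfolding D \<rho> using len by (simp add: power2_eq_square field_simps)
    finally show ?thesis .
  qed
  have total: "(r ?p - r ?q)\<^sup>2 / ?L + (?L - \<rho>)\<^sup>2 / (3 * ?L) = D\<^sup>2 * ?L + \<kappa>\<^sup>2 * ?L ^ 3 / 3"
    unfolding D \<rho> using len by (simp add: power2_eq_square power3_eq_cube field_simps)
  show ?thesis
  proof (cases "\<exists>u. y = Inner e u")
    case True
    then obtain u where yu: "y = Inner e u" by blast
    then have u: "0 < u" "u < ?L" using y by (auto simp: points_def)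
    define \<theta> where "\<theta> = u / ?L"
    have u\<theta>: "u = \<theta> * ?L" using len by (simp add: \<theta>_def)
    have "?R s = r ?p + (D + \<kappa> * ?L + 2 * \<theta> - 2) * s + (- \<kappa>) * s\<^sup>2" if "0 < s" "s < u" for s
      using that u len R[OF that(1) less_trans[OF that(2) u(2)]] by (simp add: yu \<theta>_def power2_eq_square algebra_simps)
    from has_integral_deriv_square_quadratic[OF less_imp_le[OF u(1)] this]
    have 1: "((\<lambda>t. (deriv ?R t)\<^sup>2) has_integral ((D + \<kappa> * ?L + 2 * \<theta> - 2)\<^sup>2 * (u - 0)
      + 2 * (D + \<kappa> * ?L + 2 * \<theta> - 2) * - \<kappa> * (u\<^sup>2 - 0\<^sup>2) + 4 / 3 * (- \<kappa>)\<^sup>2 * (u ^ 3 - 0 ^ 3))) {0..u}" .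
    have "?R s = (r ?p - 2 * u) + (D + \<kappa> * ?L + 2 * \<theta>) * s + (- \<kappa>) * s\<^sup>2" if "u < s" "s < ?L" for s
      using that u len R[OF less_trans[OF u(1) that(1)] that(2)] by (simp add: yu \<theta>_def power2_eq_square algebra_simps)
    from has_integral_deriv_square_quadratic[OF less_imp_le[OF u(2)] this]
    have 2: "((\<lambda>t. (deriv ?R t)\<^sup>2) has_integral ((D + \<kappa> * ?L + 2 * \<theta>)\<^sup>2 * (?L - u)
      + 2 * (D + \<kappa> * ?L + 2 * \<theta>) * - \<kappa> * (?L\<^sup>2 - u\<^sup>2) + 4 / 3 * (- \<kappa>)\<^sup>2 * (?L ^ 3 - u ^ 3))) {u..?L}" .
    have "step_energy e y = 4 * \<theta> * (1 - \<theta>) * \<rho>"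
      by (simp add: step_energy_def yu \<theta>_def \<rho>_def)
    \<comment> \<open>Expressed through \<open>D\<close>, \<open>\<kappa>\<close>,
      \<open>\<theta>\<close> and the length, both sides are free of division by the length, so a
      polynomial identity remains.\<close>
    then have "D\<^sup>2 * ?L + \<kappa>\<^sup>2 * ?L ^ 3 / 3 + step_energy e y
     = ((D + \<kappa> * ?L + 2 * \<theta> - 2)\<^sup>2 * (u - 0)
      + 2 * (D + \<kappa> * ?L + 2 * \<theta> - 2) * - \<kappa> * (u\<^sup>2 - 0\<^sup>2) + 4 / 3 * (- \<kappa>)\<^sup>2 * (u ^ 3 - 0 ^ 3))
      + ((D + \<kappa> * ?L + 2 * \<theta>)\<^sup>2 * (?L - u)
      + 2 * (D + \<kappa> * ?L + 2 * \<theta>) * - \<kappa> * (?L\<^sup>2 - u\<^sup>2) + 4 / 3 * (- \<kappa>)\<^sup>2 * (?L ^ 3 - u ^ 3))"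
      unfolding \<rho> u\<theta> by (simp add: field_simps) algebra
    then show ?thesis
      using has_integral_combine[OF _ _ 1 2] u unfolding total by (simp add: integral_unique)
  next
    case False
    then have "bubble (Inner e s) y = 0" for s by (cases y) auto
    then have "?R s = r ?p + (D + \<kappa> * ?L) * s + (- \<kappa>) * s\<^sup>2" if "0 < s" "s < ?L" for s
      using that by (simp add: R power2_eq_square algebra_simps)
    from has_integral_deriv_square_quadratic[OF less_imp_le[OF len] this]
    have 1: "((\<lambda>t. (deriv ?R t)\<^sup>2) has_integral ((D + \<kappa> * ?L)\<^sup>2 * (?L - 0)
      + 2 * (D + \<kappa> * ?L) * - \<kappa> * (?L\<^sup>2 - 0\<^sup>2) + 4 / 3 * (- \<kappa>)\<^sup>2 * (?L ^ 3 - 0 ^ 3))) {0..?L}" .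
    have "step_energy e y = 0"
      using False by (auto simp: step_energy_def split: point.split)
    then have "D\<^sup>2 * ?L + \<kappa>\<^sup>2 * ?L ^ 3 / 3 + step_energy e y = ((D + \<kappa> * ?L)\<^sup>2 * (?L - 0)
      + 2 * (D + \<kappa> * ?L) * - \<kappa> * (?L\<^sup>2 - 0\<^sup>2) + 4 / 3 * (- \<kappa>)\<^sup>2 * (?L ^ 3 - 0 ^ 3))"
      by (simp add: power2_eq_square power3_eq_cube field_simps)
    then show ?thesis
      using 1 unfolding total by (simp add: integral_unique)
  qed
qed

text \<open>For \<open>y\<close> at fraction \<open>\<theta>\<close> of an edge, interpolating the
  diagonal of \<open>g\<close> exceeds interpolating \<open>g\<close> twice by
  \<open>\<theta> * (1 - \<theta>)\<close> times the resistance between the ends.\<close>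

lemma sum_step_energy:
  assumes "y \<in> points G l"
  shows "(\<Sum>e\<in>arcs G. step_energy e y) =
    4 * (interpolate (\<lambda>v. g v v) y - interpolate (\<lambda>v. interpolate (\<lambda>w. g w v) y) y)"
proof (cases y)
  case (Vertex v)
  then show ?thesis by (simp add: step_energy_def)
next
  case (Inner e u)
  then have e: "e \<in> arcs G" using assms by (auto simp: points_def)
  then show ?thesis
    using green_commute[of "tail G e" "head G e"] length_pos[OF e]
    by (simp add: step_energy_def Inner field_simps)
qed

lemma tau_at_eq:
  assumes y: "y \<in> points G l"
  shows "tau_at G l y = 1/4 * (\<Sum>e\<in>arcs G. (g (tail G e) (tail G e) - g (head G e) (head G e))\<^sup>2 / l e
    + (l e - network_resistance G l (tail G e) (head G e))\<^sup>2 / (3 * l e))"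
proof -
  let ?d = "\<lambda>v. g v v" and ?c = "\<lambda>v. interpolate (\<lambda>w. g w v) y"
  define r where "r = (\<lambda>v. g v v + point_green y y - 2 * ?c v)"
  let ?E = "dirichlet G l"
  have c: "?E ?c f = interpolate f y - f z" for f
    by (rule dirichlet_interpolate_green[OF y])
  have zero: "?d z = 0" "?c z = 0"
    using y base_in_verts by (auto simp: green_base points_def)
  have "?E r r = ?E (\<lambda>v. ?d v - 2 * ?c v) (\<lambda>v. ?d v - 2 * ?c v)"
  proof -
    have "r u - r v = (?d u - 2 * ?c u) - (?d v - 2 * ?c v)" for u v
      by (simp add: r_def)
    then show ?thesis by (simp only: dirichlet_def)
  qed
  \<comment> \<open>Pairing with \<open>?c\<close> interpolates at \<open>y\<close> and subtracts
    the value at \<open>z\<close>, so the two terms containing \<open>?c\<close> amount to minus the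
    total step energy.\<close>
  also have "\<dots> = ?E ?d ?d - 4 * ?E ?c ?d + 4 * ?E ?c ?c"
    by (simp add: dirichlet_diff_left dirichlet_cmult_left 
        dirichlet_commute[of G l _ "\<lambda>v. ?d v - 2 * ?c v"] dirichlet_commute[of G l ?d ?c])
  also have "\<dots> = ?E ?d ?d - (\<Sum>e\<in>arcs G. step_energy e y)"
    by (simp add: c zero sum_step_energy[OF y])
  finally have "?E r r + (\<Sum>e\<in>arcs G. step_energy e y) = ?E ?d ?d" by simp
  moreover have "tau_at G l y = 1/4 * (\<Sum>e\<in>arcs G. (r (tail G e) - r (head G e))\<^sup>2 / l e
    + (l e - network_resistance G l (tail G e) (head G e))\<^sup>2 / (3 * l e) + step_energy e y)"
    unfolding tau_at_def r_def
    by (simp add: integral_deriv_eff_resistance[OF y] resistance_green)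
  ultimately show ?thesis
    by (simp add: sum.distrib dirichlet_def power2_eq_square)
qed

end

context metrized_graph
begin

lemma points_nonempty: "points G l \<noteq> {}"
  using connected by (auto simp: points_def Digraph_Component.connected_def strongly_connected_def mk_symmetric_def)

text \<open>The right-hand side of \<open>tau_at_eq\<close> is free of \<open>y\<close>, so the
  point chosen by \<open>SOME\<close> is immaterial; the values \<open>g v v\<close> are the
  resistances to \<open>z\<close>.\<close>

theorem tau_eq:
  assumes "z \<in> verts G"
  shows "tau G l = 1/4 * (\<Sum>e\<in>arcs G.
      (network_resistance G l (tail G e) z - network_resistance G l (head G e) z)\<^sup>2 / l e
      + (l e - network_resistance G l (tail G e) (head G e))\<^sup>2 / (3 * l e))"
proof -
  obtain g where "green_function G l z g"
    using ex_green assms by blast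
  then interpret green_function G l z g .
  interpret metrized_green G l z g by unfold_locales
  show ?thesis
    unfolding tau_def
    by (subst tau_at_eq) (auto simp: some_in_eq points_nonempty resistance_green_base)
qed

end

section \<open>Scaling of the lengths\<close>

lemma is_potential_scale:
  assumes "c \<noteq> 0" "is_potential N R u v \<phi>"
  shows "is_potential N (\<lambda>e. c * R e) u v (\<lambda>x. c * \<phi> x)"
proof -
  have "dirichlet N (\<lambda>e. c * R e) (\<lambda>x. c * \<phi> x) f = dirichlet N R \<phi> f" for f
    using assms(1) by (simp add: dirichlet_def right_diff_distrib[symmetric])
  then show ?thesis using assms(2) by (simp add: is_potential_def)
qed

context metrized_graph
begin

lemma metrized_graph_scale: "c > 0 \<Longrightarrow> metrized_graph G (\<lambda>e. c * l e)"
  by unfold_locales (auto simp: connected length_pos)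

lemma network_resistance_scale:
  assumes "c > 0" "u \<in> verts G" "v \<in> verts G"
  shows "network_resistance G (\<lambda>e. c * l e) u v = c * network_resistance G l u v"
proof -
  interpret s: metrized_graph G "\<lambda>e. c * l e"
    using assms(1) by (rule metrized_graph_scale)
  obtain \<phi> where "is_potential G l u v \<phi>"
    using ex_potential assms by blast
  then show ?thesis
    using is_potential_scale[of c G l u v \<phi>] assms
    by (simp add: network_resistance_eq s.network_resistance_eq right_diff_distrib)
qed

lemma tau_scale:
  assumes "c > 0"
  shows "tau G (\<lambda>e. c * l e) = c * tau G l"
proof -
  interpret s: metrized_graph G "\<lambda>e. c * l e"
    using assms(1) by (rule metrized_graph_scale)
  obtain z where z: "z \<in> verts G"
    using points_nonempty by (auto simp: points_def dest: tail_in_verts)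
  show ?thesis
    unfolding tau_eq[OF z] s.tau_eq[OF z] mult.left_commute[of c] sum_distrib_left
  proof (intro arg_cong[where f = "\<lambda>x. 1/4 * x"] sum.cong refl)
    fix e assume e: "e \<in> arcs G"
    show "(network_resistance G (\<lambda>e. c * l e) (tail G e) z
        - network_resistance G (\<lambda>e. c * l e) (head G e) z)\<^sup>2 / (c * l e)
      + (c * l e - network_resistance G (\<lambda>e. c * l e) (tail G e) (head G e))\<^sup>2 / (3 * (c * l e))
      = c * ((network_resistance G l (tail G e) z - network_resistance G l (head G e) z)\<^sup>2 / l e
      + (l e - network_resistance G l (tail G e) (head G e))\<^sup>2 / (3 * l e))"
      using assms length_pos[OF e] e z
      by (simp add: network_resistance_scale right_diff_distrib[symmetric] power_mult_distrib
          power2_eq_square add_divide_distrib distrib_left mult.commute mult.left_commute)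
  qed
qed

end

section \<open>Cubic expansions\<close>

text \<open>Each fibre is listed and rotated cyclically. The orbits of \<open>\<sigma>\<close> are
  the cycles that replace the vertices.\<close>

lemma ex_fibrewise_cyclic_permutation:
  fixes \<pi> :: "'a \<Rightarrow> 'b"
  assumes "finite W"
  shows "\<exists>\<sigma>. \<sigma> permutes W \<and> (\<forall>w\<in>W. \<pi> (\<sigma> w) = \<pi> w) \<and>
    (\<forall>w\<in>W. \<forall>w'\<in>W. \<pi> w = \<pi> w' \<longrightarrow> (\<exists>k. w' = (\<sigma> ^^ k) w))"
proof -
  have "\<exists>xs. distinct xs \<and> set xs = {w\<in>W. \<pi> w = v}" for v
    using finite_distinct_list[of "{w\<in>W. \<pi> w = v}"] assms by auto
  then obtain xs where xs: "\<And>v. distinct (xs v)" "\<And>v. set (xs v) = {w\<in>W. \<pi> w = v}"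
    by metis
  define c where "c v = cycle_of_list (xs v)" for v
  have perm: "c v permutes {w\<in>W. \<pi> w = v}" for v
    using cycle_permutes[of "xs v"] by (simp add: c_def xs)
  define \<sigma> where "\<sigma> w = (if w \<in> W then c (\<pi> w) w else w)" for w
  have in_fibre: "\<sigma> w \<in> W" "\<pi> (\<sigma> w) = \<pi> w" if "w \<in> W" for w
    using permutes_in_image[OF perm[of "\<pi> w"], of w] that by (auto simp: \<sigma>_def)
  have "inj_on \<sigma> W"
  proof (rule inj_onI)
    fix w w' assume w: "w \<in> W" "w' \<in> W" "\<sigma> w = \<sigma> w'"
    then have "\<pi> w = \<pi> w'" using in_fibre(2) by metis
    then show "w = w'"
      using w permutes_inj[OF perm[of "\<pi> w"]] by (auto simp: \<sigma>_def dest: injD)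
  qed
  then have "bij_betw \<sigma> W W"
    using in_fibre(1) by (intro bij_betw_imageI endo_inj_surj assms) auto
  then have "\<sigma> permutes W"
    by (rule bij_imp_permutes) (simp add: \<sigma>_def)
  moreover have "\<exists>k. w' = (\<sigma> ^^ k) w" if w: "w \<in> W" "w' \<in> W" "\<pi> w = \<pi> w'" for w w'
  proof -
    let ?xs = "xs (\<pi> w)"
    have "w \<in> set ?xs" "w' \<in> set ?xs" using w by (auto simp: xs)
    then obtain i j where ij: "i < length ?xs" "j < length ?xs" "w = ?xs ! i" "w' = ?xs ! j"
      by (auto simp: in_set_conv_nth)
    \<comment> \<open>Then \<open>i + k\<close> is \<open>j\<close> plus the length of the list;
      adding the length keeps the subtraction of naturals harmless when
      \<open>j < i\<close>.\<close>
    define k where "k = j + (length ?xs - i)"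
    have "(c (\<pi> w) ^^ k) w = rotate k ?xs ! i"
      using cyclic_rotation[OF xs(1)[of "\<pi> w"], of k, symmetric] ij by (simp add: c_def)
    also have "\<dots> = w'"
      using ij by (simp add: nth_rotate k_def)
    finally have "(c (\<pi> w) ^^ k) w = w'" .
    \<comment> \<open>The orbit of \<open>w\<close> stays in its fibre, where
      \<open>\<sigma>\<close> acts as the one cycle \<open>c (\<pi> w)\<close>.\<close>
    moreover have "(\<sigma> ^^ m) w = (c (\<pi> w) ^^ m) w \<and> (\<sigma> ^^ m) w \<in> W \<and> \<pi> ((\<sigma> ^^ m) w) = \<pi> w" for m
      using w in_fibre by (induction m) (auto simp: \<sigma>_def)
    ultimately show ?thesis by metis
  qed
  ultimately show ?thesis using in_fibre by blast
qed

text \<open>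
  The nodes \<open>2 * i\<close> and \<open>2 * i + 1\<close> are the tail and the head half-edge of the \<open>i\<close>-th edge. The
  arcs below \<open>n\<close> are the original edges, and the arc \<open>n + w\<close> joins \<open>w\<close> to the next half-edge
  \<open>\<sigma> w\<close> at the same vertex.
\<close>

definition expansion :: "nat \<Rightarrow> (nat \<Rightarrow> nat) \<Rightarrow> (nat, nat) pre_digraph" where
  "expansion n \<sigma> = \<lparr> verts = {..<2 * n}, arcs = {..<3 * n},
     tail = (\<lambda>i. if i < n then 2 * i else i - n),
     head = (\<lambda>i. if i < n then 2 * i + 1 else \<sigma> (i - n)) \<rparr>"

lemma expansion_simps:
  "verts (expansion n \<sigma>) = {..<2 * n}"
  "arcs (expansion n \<sigma>) = {..<3 * n}"
  "i < n \<Longrightarrow> tail (expansion n \<sigma>) i = 2 * i"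
  "i < n \<Longrightarrow> head (expansion n \<sigma>) i = 2 * i + 1"
  "tail (expansion n \<sigma>) (n + w) = w"
  "head (expansion n \<sigma>) (n + w) = \<sigma> w"
  by (simp_all add: expansion_def)

lemma sum_arcs_expansion:
  fixes F :: "nat \<Rightarrow> real"
  shows "(\<Sum>i\<in>arcs (expansion n \<sigma>). F i) = (\<Sum>i<n. F i) + (\<Sum>w<2*n. F (n + w))"
proof -
  have "(+) n ` {..<2 * n} = {n..<3 * n}"
    using image_add_atLeastLessThan[of n 0 "2 * n"] by (simp add: lessThan_atLeast0)
  then have "{..<3 * n} = {..<n} \<union> (+) n ` {..<2 * n}"
    by auto
  moreover have "sum F ({..<n} \<union> (+) n ` {..<2 * n}) = sum F {..<n} + sum F ((+) n ` {..<2 * n})"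
    by (rule sum.union_disjoint) auto
  ultimately show ?thesis
    by (simp add: expansion_simps sum.reindex)
qed

text \<open>At \<open>w\<close> meet the cycle arc leaving \<open>w\<close>, the cycle arc from its
  predecessor \<open>x\<close>, and one end of the original edge \<open>w div 2\<close>. If
  \<open>\<sigma>\<close> fixes \<open>w\<close>, the two cycle arcs are one loop, counted
  twice.\<close>

lemma cubic_expansion:
  assumes \<sigma>: "\<sigma> permutes {..<2 * n}" and "n > 0"
  shows "cubic (expansion n \<sigma>) k"
proof -
  let ?B = "expansion n \<sigma>"
  have "valence ?B (Vertex w) = 3" if w: "w < 2 * n" for w
  proof -
    have out: "out_arcs ?B w = insert (n + w) (if even w then {w div 2} else {})"
      using w by (auto simp: expansion_def)
    have "w \<in> \<sigma> ` {..<2 * n}"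
      using permutes_image[OF \<sigma>] w by simp
    then obtain x where x: "x < 2 * n" "\<sigma> x = w"
      by auto
    have mem: "i \<in> in_arcs ?B w \<longleftrightarrow> i = n + x \<or> (odd w \<and> i = w div 2)" for i
    proof (cases "i < n")
      case True
      then have "i \<in> in_arcs ?B w \<longleftrightarrow> 2 * i + 1 = w"
        by (auto simp: expansion_simps)
      also have "\<dots> \<longleftrightarrow> odd w \<and> i = w div 2"
        by presburger
      finally show ?thesis using True by auto
    next
      case False
      define y where "y = i - n"
      then have y: "i = n + y" using False by simp
      have "w div 2 < n" using w by linarith
      moreover have "i \<in> in_arcs ?B w \<longleftrightarrow> y < 2 * n \<and> \<sigma> y = w"
        by (auto simp: y expansion_simps)
      moreover have "\<sigma> y = w \<longleftrightarrow> y = x"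
        using inj_eq[OF permutes_inj[OF \<sigma>], of y x] by (simp add: x)
      moreover have "i \<noteq> w div 2" using False \<open>w div 2 < n\<close> by simp
      moreover have "i = n + x \<longleftrightarrow> y = x" by (simp add: y)
      ultimately show ?thesis using x(1) by metis
    qed
    have "in_arcs ?B w = insert (n + x) (if odd w then {w div 2} else {})"
      by (rule set_eqI, unfold mem) simp
    moreover have "w div 2 < n" using w by linarith
    ultimately show ?thesis
      using w out by (auto simp: out_degree_def in_degree_def card_insert_if)
  qed
  moreover have "0 \<in> {..<2 * n}" using \<open>n > 0\<close> by simp
  then have "{..<2 * n} \<noteq> {}" by blast
  ultimately have "is_vertex_set ?B k (Vertex ` {..<2 * n}) \<and> (\<forall>p\<in>Vertex ` {..<2 * n}. valence ?B p = 3)"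
    by (auto simp: is_vertex_set_def points_def expansion_simps simp del: valence.simps(1))
  then show ?thesis unfolding cubic_def by blast
qed

text \<open>\<open>\<pi>\<close> is the contraction, sending a half-edge to its vertex; the last
  three assumptions say that the orbits of \<open>\<sigma>\<close> on the nodes are exactly the
  fibres of \<open>\<pi>\<close>.\<close>

locale expanded_graph = metrized_graph G l for G :: "('v,'e) pre_digraph" and l +
  fixes n :: nat and a :: "nat \<Rightarrow> 'e" and \<pi> :: "nat \<Rightarrow> 'v" and \<sigma> :: "nat \<Rightarrow> nat"
  assumes enum: "bij_betw a {..<n} (arcs G)" and n_pos: "n > 0"
    and proj_even: "i < n \<Longrightarrow> \<pi> (2 * i) = tail G (a i)"
    and proj_odd: "i < n \<Longrightarrow> \<pi> (2 * i + 1) = head G (a i)"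
    and permutes: "\<sigma> permutes {..<2 * n}"
    and proj_perm: "w < 2 * n \<Longrightarrow> \<pi> (\<sigma> w) = \<pi> w"
    and fibre_orbit: "w < 2 * n \<Longrightarrow> w' < 2 * n \<Longrightarrow> \<pi> w = \<pi> w' \<Longrightarrow> \<exists>k. w' = (\<sigma> ^^ k) w"
begin

abbreviation "B \<equiv> expansion n \<sigma>"

text \<open>The original lengths are kept, so the expansion is longer than \<open>G\<close> by
  \<open>2 * n * \<epsilon>\<close>; it is normalized only at the end, by scaling.\<close>

definition len :: "real \<Rightarrow> nat \<Rightarrow> real" where
  "len \<epsilon> i = (if i < n then l (a i) else \<epsilon>)"

lemma len_simps [simp]: "i < n \<Longrightarrow> len \<epsilon> i = l (a i)" "len \<epsilon> (n + w) = \<epsilon>"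
  by (simp_all add: len_def)

lemma arc_enum: "i < n \<Longrightarrow> a i \<in> arcs G"
  using enum by (auto simp: bij_betw_def)

lemma sum_arcs_enum: "(\<Sum>e\<in>arcs G. F e) = (\<Sum>i<n. F (a i))"
  using sum.reindex_bij_betw[OF enum, of F] by simp

lemma perm_less: "w < 2 * n \<Longrightarrow> \<sigma> w < 2 * n"
  using permutes_in_image[OF permutes, of w] by simp

lemma proj_in_verts:
  assumes "w < 2 * n"
  shows "\<pi> w \<in> verts G"
proof -
  have i: "w div 2 < n" using assms by linarith
  show ?thesis
  proof (cases "even w")
    case True
    then have "w = 2 * (w div 2)" by simp
    then show ?thesis using proj_even[OF i] arc_enum[OF i] by (metis tail_in_verts)
  next
    case False
    then have "w = 2 * (w div 2) + 1" by simp
    then show ?thesis using proj_odd[OF i] arc_enum[OF i] by (metis head_in_verts)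
  qed
qed

lemma fin_digraph_expansion: "fin_digraph B"
proof
  fix i assume "i \<in> arcs B"
  then show "tail B i \<in> verts B" "head B i \<in> verts B"
    using perm_less[of "i - n"] by (auto simp: expansion_def)
qed (auto simp: expansion_def)

text \<open>An invariant predicate is constant on the orbits of \<open>\<sigma>\<close>, hence on
  the fibres of \<open>\<pi>\<close>. It therefore descends to a predicate \<open>Q\<close> on the
  vertices of \<open>G\<close>, to which the connectedness of \<open>G\<close> applies.\<close>

lemma connected_expansion: "Digraph_Component.connected B"
proof (rule digraph_connectedI)
  interpret B: fin_digraph B by (rule fin_digraph_expansion)
  show "wf_digraph B" by unfold_locales
  have "0 \<in> verts B" using n_pos by (simp add: expansion_simps)
  then show "verts B \<noteq> {}" by blast
next
  fix P u v
  assume step: "\<And>e. e \<in> arcs B \<Longrightarrow> P (tail B e) \<longleftrightarrow> P (head B e)"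
    and uv: "u \<in> verts B" "P u" "v \<in> verts B"
  have lt: "u < 2 * n" "v < 2 * n" using uv by (auto simp: expansion_simps)
  have perm: "P w \<longleftrightarrow> P (\<sigma> w)" if "w < 2 * n" for w
    using step[of "n + w"] that by (simp add: expansion_simps)
  have funpow: "(\<sigma> ^^ k) w < 2 * n \<and> (P w \<longleftrightarrow> P ((\<sigma> ^^ k) w))" if "w < 2 * n" for w k
    using that perm perm_less by (induction k) auto
  have fibre: "P w \<longleftrightarrow> P w'" if "w < 2 * n" "w' < 2 * n" "\<pi> w = \<pi> w'" for w w'
    using fibre_orbit[OF that] funpow[OF that(1)] by metis
  define Q where "Q x \<longleftrightarrow> (\<exists>w<2 * n. \<pi> w = x \<and> P w)" for x
  have Q: "Q (\<pi> w) \<longleftrightarrow> P w" if "w < 2 * n" for w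
    unfolding Q_def using fibre[OF _ that] that by blast
  have "Q (\<pi> v)"
  proof (rule digraph_connected_induct[OF wf_digraph connected proj_in_verts[OF lt(1)] _ proj_in_verts[OF lt(2)]])
    show "Q (\<pi> u)" using Q lt uv by simp
    fix e assume "e \<in> arcs G"
    then obtain i where i: "i < n" "e = a i" using enum by (auto simp: bij_betw_def)
    then have "P (2 * i) \<longleftrightarrow> P (2 * i + 1)"
      using step[of i] by (simp add: expansion_simps)
    then show "Q (tail G e) \<longleftrightarrow> Q (head G e)"
      using Q[of "2 * i"] Q[of "2 * i + 1"] i proj_even[OF i(1)] proj_odd[OF i(1)] by simp
  qed
  then show "P v" using Q lt by simp
qed

lemma metrized_expansion: "\<epsilon> > 0 \<Longrightarrow> metrized_graph B (len \<epsilon>)"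
proof -
  assume "\<epsilon> > 0"
  interpret B: fin_digraph B by (rule fin_digraph_expansion)
  show ?thesis
    using \<open>\<epsilon> > 0\<close> connected_expansion length_pos arc_enum by unfold_locales (auto simp: len_def)
qed

lemma dirichlet_expansion:
  "dirichlet B (len \<epsilon>) f h = (\<Sum>i<n. (f (2 * i) - f (2 * i + 1)) * (h (2 * i) - h (2 * i + 1)) / l (a i))
    + (\<Sum>w<2*n. (f w - f (\<sigma> w)) * (h w - h (\<sigma> w)) / \<epsilon>)"
  unfolding dirichlet_def sum_arcs_expansion by (simp add: expansion_simps)

section \<open>Contraction limit\<close>

text \<open>Along a contracted arc the potential drops by at most \<open>\<epsilon>\<close>, so in the limit it descends to
  \<open>G\<close>, where it is compared with the potential of \<open>G\<close> by reciprocity.\<close>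

lemma resistance_expansion_tendsto:
  assumes w: "w < 2 * n" "w' < 2 * n"
  shows "((\<lambda>\<epsilon>. network_resistance B (len \<epsilon>) w w') \<longlongrightarrow> network_resistance G l (\<pi> w) (\<pi> w')) (at_right 0)"
proof -
  define \<phi> where "\<phi> \<epsilon> = (SOME \<phi>. is_potential B (len \<epsilon>) w w' \<phi>)" for \<epsilon>
  have wV: "w \<in> verts B" "w' \<in> verts B" using w by (auto simp: expansion_simps)
  have pot: "is_potential B (len \<epsilon>) w w' (\<phi> \<epsilon>)" if "\<epsilon> > 0" for \<epsilon>
  proof -
    interpret b: metrized_graph B "len \<epsilon>" by (rule metrized_expansion[OF that])
    show ?thesis unfolding \<phi>_def using b.ex_potential[OF wV] by (rule someI_ex)
  qed
  have res: "network_resistance B (len \<epsilon>) w w' = \<phi> \<epsilon> w - \<phi> \<epsilon> w'" if "\<epsilon> > 0" for \<epsilon>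
  proof -
    interpret b: metrized_graph B "len \<epsilon>" by (rule metrized_expansion[OF that])
    show ?thesis using b.network_resistance_eq[OF wV pot[OF that]] .
  qed
  have drop: "\<bar>\<phi> \<epsilon> x - \<phi> \<epsilon> (\<sigma> x)\<bar> \<le> \<epsilon>" if "\<epsilon> > 0" "x < 2 * n" for \<epsilon> x
  proof -
    interpret b: metrized_graph B "len \<epsilon>" by (rule metrized_expansion[OF that(1)])
    show ?thesis
      using b.potential_drop_le[OF wV pot[OF that(1)], of "n + x"] that(2) by (simp add: expansion_simps)
  qed
  have drops: "\<bar>\<phi> \<epsilon> x - \<phi> \<epsilon> ((\<sigma> ^^ k) x)\<bar> \<le> real k * \<epsilon> \<and> (\<sigma> ^^ k) x < 2 * n" if "\<epsilon> > 0" "x < 2 * n" for \<epsilon> x k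
  proof (induction k)
    case (Suc k)
    then show ?case
      using drop[OF that(1), of "(\<sigma> ^^ k) x"] perm_less[of "(\<sigma> ^^ k) x"] by (auto simp: algebra_simps)
  qed (use that in auto)
  \<comment> \<open>A section of \<open>\<pi>\<close>: composing with it turns the potential on the
    expansion into a test function on \<open>G\<close>.\<close>
  define rep where "rep v = (SOME x. x < 2 * n \<and> \<pi> x = v)" for v
  have rep: "rep (\<pi> x) < 2 * n" "\<pi> (rep (\<pi> x)) = \<pi> x" if "x < 2 * n" for x
    using someI[of "\<lambda>y. y < 2 * n \<and> \<pi> y = \<pi> x" x] that by (auto simp: rep_def)
  \<comment> \<open>This measures how far \<open>\<phi> \<epsilon>\<close> is from factoring through
    \<open>\<pi>\<close>. It is at most \<open>\<epsilon>\<close> times the number of cycle arcs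
    walked from \<open>x\<close> to its representative.\<close>
  define \<eta> where "\<eta> x \<epsilon> = \<phi> \<epsilon> (rep (\<pi> x)) - \<phi> \<epsilon> x" for x \<epsilon>
  have \<eta>: "(\<eta> x \<longlongrightarrow> 0) (at_right 0)" if x: "x < 2 * n" for x
  proof -
    obtain k where k: "rep (\<pi> x) = (\<sigma> ^^ k) x"
      using fibre_orbit[OF x rep(1)[OF x]] rep(2)[OF x] by auto
    have "\<forall>\<^sub>F \<epsilon> in at_right 0. norm (\<eta> x \<epsilon>) \<le> real k * \<epsilon>"
      using drops[OF _ x, of _ k] by (auto simp: eventually_at_right_less \<eta>_def k abs_minus_commute
          intro: eventually_mono[OF eventually_at_right_less[of 0]])
    moreover have "((\<lambda>\<epsilon>. real k * \<epsilon>) \<longlongrightarrow> 0) (at_right 0)"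
      by (auto intro!: tendsto_eq_intros)
    ultimately show ?thesis by (rule Lim_null_comparison)
  qed
  obtain \<gamma> where \<gamma>: "is_potential G l (\<pi> w) (\<pi> w') \<gamma>"
    using ex_potential proj_in_verts w by blast
  have rG: "network_resistance G l (\<pi> w) (\<pi> w') = \<gamma> (\<pi> w) - \<gamma> (\<pi> w')"
    using network_resistance_eq[OF _ _ \<gamma>] proj_in_verts w by simp
  define d where "d i = (\<gamma> (tail G (a i)) - \<gamma> (head G (a i))) / l (a i)" for i
  \<comment> \<open>The potential of the expansion is tested against \<open>\<gamma>\<close>
    composed with \<open>\<pi>\<close>, which is constant along cycle arcs and so has no
    1/\<open>\<epsilon>\<close> terms; \<open>\<gamma>\<close> is tested against
    \<open>\<phi> \<epsilon>\<close> composed with \<open>rep\<close>. Subtracting leaves only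
    values of \<open>\<eta>\<close>.\<close>
  have "network_resistance B (len \<epsilon>) w w' = network_resistance G l (\<pi> w) (\<pi> w')
      + (\<Sum>i<n. d i * (\<eta> (2 * i) \<epsilon> - \<eta> (2 * i + 1) \<epsilon>)) - \<eta> w \<epsilon> + \<eta> w' \<epsilon>" if \<epsilon>: "\<epsilon> > 0" for \<epsilon>
  proof -
    have "\<gamma> (\<pi> w) - \<gamma> (\<pi> w') = (\<Sum>i<n. d i * (\<phi> \<epsilon> (2 * i) - \<phi> \<epsilon> (2 * i + 1)))"
      using is_potentialD[OF pot[OF \<epsilon>], of "\<lambda>x. \<gamma> (\<pi> x)"] proj_even proj_odd proj_perm
      by (simp add: dirichlet_expansion d_def mult.commute)
    moreover have "\<phi> \<epsilon> (rep (\<pi> w)) - \<phi> \<epsilon> (rep (\<pi> w')) =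
        (\<Sum>i<n. d i * (\<phi> \<epsilon> (rep (\<pi> (2 * i))) - \<phi> \<epsilon> (rep (\<pi> (2 * i + 1)))))"
      using is_potentialD[OF \<gamma>, of "\<lambda>v. \<phi> \<epsilon> (rep v)"] proj_even proj_odd
      by (simp add: dirichlet_def sum_arcs_enum d_def)
    ultimately show ?thesis
      unfolding rG res[OF \<epsilon>]
      by (simp add: \<eta>_def right_diff_distrib sum_subtractf)
  qed
  then have "\<forall>\<^sub>F \<epsilon> in at_right 0. network_resistance G l (\<pi> w) (\<pi> w')
      + (\<Sum>i<n. d i * (\<eta> (2 * i) \<epsilon> - \<eta> (2 * i + 1) \<epsilon>)) - \<eta> w \<epsilon> + \<eta> w' \<epsilon> = network_resistance B (len \<epsilon>) w w'"
    by (intro eventually_mono[OF eventually_at_right_less[of 0]]) simp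
  moreover have "((\<lambda>\<epsilon>. network_resistance G l (\<pi> w) (\<pi> w')
      + (\<Sum>i<n. d i * (\<eta> (2 * i) \<epsilon> - \<eta> (2 * i + 1) \<epsilon>)) - \<eta> w \<epsilon> + \<eta> w' \<epsilon>)
      \<longlongrightarrow> network_resistance G l (\<pi> w) (\<pi> w') + (\<Sum>i<n. d i * (0 - 0)) - 0 + 0) (at_right 0)"
    using w by (intro tendsto_intros \<eta>) auto
  ultimately show ?thesis
    by (auto intro: Lim_transform_eventually)
qed

text \<open>In \<open>tau_eq\<close> with base node 0, a cycle arc contributes at most
  \<open>\<epsilon>\<close> plus a third of \<open>\<epsilon>\<close>, bounded by
  \<open>2 * \<epsilon>\<close>. With \<open>2 * n\<close> such arcs and the factor 1/4 this gives
  \<open>n * \<epsilon>\<close>.\<close>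

lemma tau_expansion_le:
  assumes \<epsilon>: "\<epsilon> > 0"
  shows "tau B (len \<epsilon>) \<le> 1/4 * (\<Sum>i<n.
      (network_resistance B (len \<epsilon>) (2 * i) 0 - network_resistance B (len \<epsilon>) (2 * i + 1) 0)\<^sup>2 / l (a i)
      + (l (a i) - network_resistance B (len \<epsilon>) (2 * i) (2 * i + 1))\<^sup>2 / (3 * l (a i))) + real n * \<epsilon>"
proof -
  interpret b: metrized_graph B "len \<epsilon>" by (rule metrized_expansion[OF \<epsilon>])
  let ?r = "network_resistance B (len \<epsilon>)"
  have z: "0 \<in> verts B" using n_pos by (simp add: expansion_simps)
  have "(?r w 0 - ?r (\<sigma> w) 0)\<^sup>2 / \<epsilon> + (\<epsilon> - ?r w (\<sigma> w))\<^sup>2 / (3 * \<epsilon>) \<le> 2 * \<epsilon>" if w: "w < 2 * n" for w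
  proof -
    have V: "w \<in> verts B" "\<sigma> w \<in> verts B" using w perm_less by (auto simp: expansion_simps)
    have r: "0 \<le> ?r w (\<sigma> w)" "?r w (\<sigma> w) \<le> \<epsilon>"
      using b.resistance_nonneg[OF V] b.resistance_arc_le[of "n + w"] w by (auto simp: expansion_simps)
    then have "\<bar>?r w 0 - ?r (\<sigma> w) 0\<bar> \<le> \<bar>\<epsilon>\<bar>"
      using b.resistance_lipschitz[OF V z] \<epsilon> by linarith
    then have "(?r w 0 - ?r (\<sigma> w) 0)\<^sup>2 \<le> \<epsilon>\<^sup>2"
      by (simp only: abs_le_square_iff)
    then have "(?r w 0 - ?r (\<sigma> w) 0)\<^sup>2 / \<epsilon> \<le> \<epsilon>\<^sup>2 / \<epsilon>"
      using \<epsilon> by (intro divide_right_mono) auto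
    moreover have "(\<epsilon> - ?r w (\<sigma> w))\<^sup>2 / (3 * \<epsilon>) \<le> \<epsilon>\<^sup>2 / (3 * \<epsilon>)"
      using r \<epsilon> by (intro divide_right_mono power_mono) auto
    ultimately show ?thesis using \<epsilon> by (simp add: power2_eq_square)
  qed
  then have "(\<Sum>w<2*n. (?r w 0 - ?r (\<sigma> w) 0)\<^sup>2 / \<epsilon> + (\<epsilon> - ?r w (\<sigma> w))\<^sup>2 / (3 * \<epsilon>)) \<le> (\<Sum>w<2*n. 2 * \<epsilon>)"
    by (intro sum_mono) auto
  then show ?thesis
    unfolding b.tau_eq[OF z] sum_arcs_expansion by (simp add: expansion_simps)
qed

text \<open>The bound of \<open>tau_expansion_le\<close> is a finite sum over the original edges, so
  it converges termwise to the formula for \<open>G\<close> with base vertex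
  \<open>\<pi> 0\<close>.\<close>

lemma tau_ge_of_expansion:
  assumes ge: "\<And>\<epsilon>. \<epsilon> > 0 \<Longrightarrow> C \<le> tau B (len \<epsilon>)"
  shows "C \<le> tau G l"
proof -
  have z: "\<pi> 0 \<in> verts G" using n_pos by (intro proj_in_verts) simp
  let ?r = "\<lambda>\<epsilon>. network_resistance B (len \<epsilon>)" and ?R = "network_resistance G l"
  have len_nz: "l (a i) \<noteq> 0" if "i < n" for i
    using length_pos[OF arc_enum[OF that]] by simp
  let ?t = "\<lambda>\<epsilon>. 1/4 * (\<Sum>i<n. (?r \<epsilon> (2 * i) 0 - ?r \<epsilon> (2 * i + 1) 0)\<^sup>2 / l (a i)
      + (l (a i) - ?r \<epsilon> (2 * i) (2 * i + 1))\<^sup>2 / (3 * l (a i))) + real n * \<epsilon>"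
  have ev: "\<forall>\<^sub>F \<epsilon> in at_right 0. C \<le> ?t \<epsilon>"
    using order_trans[OF ge tau_expansion_le]
    by (intro eventually_mono[OF eventually_at_right_less[of 0]]) simp
  have lim: "(?t \<longlongrightarrow> 1/4 * (\<Sum>i<n. (?R (\<pi> (2 * i)) (\<pi> 0) - ?R (\<pi> (2 * i + 1)) (\<pi> 0))\<^sup>2 / l (a i)
      + (l (a i) - ?R (\<pi> (2 * i)) (\<pi> (2 * i + 1)))\<^sup>2 / (3 * l (a i))) + real n * 0) (at_right 0)"
  proof (intro tendsto_add tendsto_mult_left tendsto_sum tendsto_ident_at)
    fix i assume "i \<in> {..<n}"
    then have i: "i < n" by simp
    show "((\<lambda>\<epsilon>. (?r \<epsilon> (2 * i) 0 - ?r \<epsilon> (2 * i + 1) 0)\<^sup>2 / l (a i))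
      \<longlongrightarrow> (?R (\<pi> (2 * i)) (\<pi> 0) - ?R (\<pi> (2 * i + 1)) (\<pi> 0))\<^sup>2 / l (a i)) (at_right 0)"
      using i len_nz[OF i] n_pos
      by (intro tendsto_divide tendsto_power tendsto_diff tendsto_const resistance_expansion_tendsto) auto
    show "((\<lambda>\<epsilon>. (l (a i) - ?r \<epsilon> (2 * i) (2 * i + 1))\<^sup>2 / (3 * l (a i)))
      \<longlongrightarrow> (l (a i) - ?R (\<pi> (2 * i)) (\<pi> (2 * i + 1)))\<^sup>2 / (3 * l (a i))) (at_right 0)"
      using i len_nz[OF i] n_pos
      by (intro tendsto_divide tendsto_power tendsto_diff tendsto_const resistance_expansion_tendsto) auto
  qed
  have "1/4 * (\<Sum>i<n. (?R (\<pi> (2 * i)) (\<pi> 0) - ?R (\<pi> (2 * i + 1)) (\<pi> 0))\<^sup>2 / l (a i)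
      + (l (a i) - ?R (\<pi> (2 * i)) (\<pi> (2 * i + 1)))\<^sup>2 / (3 * l (a i))) + real n * 0 = tau G l"
    using proj_even proj_odd by (simp add: tau_eq[OF z] sum_arcs_enum)
  then show ?thesis
    using tendsto_lowerbound[OF lim ev trivial_limit_at_right_real] by simp
qed

end

section \<open>Existence of the expansion and the final bound\<close>

lemma (in metrized_graph) ex_expanded_graph:
  assumes "arcs G \<noteq> {}"
  shows "\<exists>n a \<pi> \<sigma>. expanded_graph G l n a \<pi> \<sigma>"
proof -
  define n where "n = card (arcs G)"
  obtain a where a: "bij_betw a {..<n} (arcs G)"
    using ex_bij_betw_nat_finite[OF finite_arcs] by (auto simp: n_def lessThan_atLeast0)
  define \<pi> where "\<pi> w = (if even w then tail G else head G) (a (w div 2))" for w :: nat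
  obtain \<sigma> where "\<sigma> permutes {..<2 * n}" "\<forall>w\<in>{..<2 * n}. \<pi> (\<sigma> w) = \<pi> w"
    "\<forall>w\<in>{..<2 * n}. \<forall>w'\<in>{..<2 * n}. \<pi> w = \<pi> w' \<longrightarrow> (\<exists>k. w' = (\<sigma> ^^ k) w)"
    using ex_fibrewise_cyclic_permutation[of "{..<2 * n}" \<pi>] by auto
  then have "expanded_graph G l n a \<pi> \<sigma>"
    using a assms finite_arcs by unfold_locales (auto simp: \<pi>_def n_def card_gt_0_iff)
  then show ?thesis by blast
qed

theorem theorem7p2:
  fixes C :: real
    and G :: "('v,'e) pre_digraph" and l :: "'e \<Rightarrow> real"
  assumes "C > 0"
    and "\<And>(B :: (nat,nat) pre_digraph) (k :: nat \<Rightarrow> real).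
           metrized_graph B k \<Longrightarrow> normalized B k \<Longrightarrow> cubic B k \<Longrightarrow> tau B k \<ge> C"
    and "metrized_graph G l" and "normalized G l"
  shows "tau G l \<ge> C"
proof -
  interpret metrized_graph G l by fact
  have total: "(\<Sum>e\<in>arcs G. l e) = 1"
    using assms(4) by (simp add: normalized_def total_length_def)
  \<comment> \<open>Length 1 excludes the one-point graph, which has no half-edges to
    expand.\<close>
  then have "arcs G \<noteq> {}" by auto
  then obtain n a \<pi> \<sigma> where "expanded_graph G l n a \<pi> \<sigma>"
    using ex_expanded_graph by blast
  then interpret expanded_graph G l n a \<pi> \<sigma> .
  show ?thesis
  proof (rule tau_ge_of_expansion)
    fix \<epsilon> :: real assume \<epsilon>: "\<epsilon> > 0"
    interpret b: metrized_graph B "len \<epsilon>" by (rule metrized_expansion[OF \<epsilon>])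
    define T where "T = 1 + 2 * real n * \<epsilon>"
    have T: "T \<ge> 1" using \<epsilon> by (simp add: T_def)
    have "(\<Sum>i\<in>arcs B. len \<epsilon> i) = T"
      using total by (simp add: sum_arcs_expansion T_def sum_arcs_enum)
    then have "normalized B (\<lambda>i. inverse T * len \<epsilon> i)"
      using T by (simp add: normalized_def total_length_def sum_distrib_left[symmetric])
    then have "C \<le> inverse T * tau B (len \<epsilon>)"
      using assms(2)[OF b.metrized_graph_scale[of "inverse T"] _ cubic_expansion[OF permutes n_pos]] T
        b.tau_scale[of "inverse T"] by simp
    \<comment> \<open>The cubic bound is applied after scaling by \<open>inverse T\<close>; scaling
      back multiplies it by \<open>T\<close>, which only strengthens it because \<open>T\<close> is
      at least 1 and \<open>C\<close> is positive.\<close>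
    then have "C * T \<le> tau B (len \<epsilon>)"
      using T by (simp add: field_simps)
    then show "C \<le> tau B (len \<epsilon>)"
      using T assms(1) by (smt (verit) mult_le_cancel_left1)
  qed
qed

end
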